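(* Let $\rho\in(0,\infty)$ and $F\in\mathcal{C}(\rho)$. Let $\{H_n\}_{n=1}^\infty$ be a sequence of bounded-degree graphs (the degree bounds need not be uniform in $n$), let $v_n,w_n$ be vertices of $H_n$, and let $t\ge 0$ be a real number. (1) If $T_{H_n}(v_n,w_n)\to t$ in probability as $n\to\infty$, then $T^F_{H_n}(v_n,w_n)\to \frac{t}{\rho}$ in probability as $n\to\infty$. (2) If $F\in\mathcal{C}_{L^1}(\rho)$ and $T_{H_n}(v_n,w_n)\to t$ in $L^1$ as $n\to\infty$, then $T^F_{H_n}(v_n,w_n)\to\frac{t}{\rho}$ in $L^1$ as $n\to\infty$. (3) If $\mathbb{P}(T_{H_n}(v_n,w_n)<t)\to0$ as $n\to\infty$, then there is a sequence $\varepsilon_n\to 0$ such that $\mathbb{P}\left(T^F_{H_n}(v_n,w_n)<\frac{t}{\rho}-\varepsilon_n\right)\to0$ as $n\to\infty$.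
   Context: Graphs: all graphs have a finite or countably infinite vertex set, bounded degree and no loops; they may have a mixture of directed and undirected edges and may have multiple edges between the same pair of vertices. A path from $v$ to $w$ is a finite sequence of consecutive edges leading from $v$ to $w$ (directed edges traversed along their direction). First-passage percolation: given a graph $H$ and a distribution $F$ on $[0,\infty)$, the edges $e$ of $H$ are given independent passage times $T^F_H(e)$ with distribution $F$; $T^F_H(\gamma)=\sum_{e\in\gamma}T^F_H(e)$ for a path $\gamma$, and $T^F_H(v,w)$ is the infimum of $T^F_H(\gamma)$ over all paths $\gamma$ from $v$ to $w$ in $H$ ($+\infty$ if there is none). When the superscript is omitted, i.e. $T_H(\cdot)$, $T_H(\cdot,\cdot)$, the passage times have the standard exponential distribution $\operatorname{Exp}(1)$. Distribution classes (identifying $F$ with its cumulative distribution function): $\mathcal{C}(\rho)=\{F\text{ non-negative distribution}:\lim_{x\downarrow0}F(x)/x=\rho\}$ and $\mathcal{C}_{L^1}(\rho)=\{F\in\mathcal{C}(\rho):\int_0^\infty x\,dF(x)<\infty\}$. *)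

theory Defs
  imports "HOL-Probability.Probability"
begin

text \<open>
  Mixed multigraphs: edges are abstract objects, so parallel edges are distinct.  An edge outside
  \<open>undirected\<close> may only be traversed from its tail to its head; for an edge in \<open>undirected\<close> the
  choice of which endpoint is called tail is immaterial.
\<close>

record ('v, 'e) mixed_graph =
  verts :: "'v set"
  edges :: "'e set"
  tail :: "'e \<Rightarrow> 'v"
  head :: "'e \<Rightarrow> 'v"
  undirected :: "'e set"

definition incident_edges :: "('v, 'e) mixed_graph \<Rightarrow> 'v \<Rightarrow> 'e set" where
  "incident_edges H v = {e \<in> edges H. tail H e = v \<or> head H e = v}"

text \<open>The degree of a vertex counts all incident edges: outgoing, incoming and undirected.\<close>

locale bounded_degree_graph =
  fixes H :: "('v, 'e) mixed_graph"
  assumes countable_verts: "countable (verts H)"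
    and tail_in_verts: "e \<in> edges H \<Longrightarrow> tail H e \<in> verts H"
    and head_in_verts: "e \<in> edges H \<Longrightarrow> head H e \<in> verts H"
    and no_loops: "e \<in> edges H \<Longrightarrow> tail H e \<noteq> head H e"
    and bounded_degree:
      "\<exists>d. \<forall>v \<in> verts H. finite (incident_edges H v) \<and> card (incident_edges H v) \<le> d"

definition traverses :: "('v, 'e) mixed_graph \<Rightarrow> 'e \<Rightarrow> 'v \<Rightarrow> 'v \<Rightarrow> bool" where
  "traverses H e u w \<longleftrightarrow> e \<in> edges H \<and>
     (tail H e = u \<and> head H e = w \<or> e \<in> undirected H \<and> tail H e = w \<and> head H e = u)"

fun is_path :: "('v, 'e) mixed_graph \<Rightarrow> 'v \<Rightarrow> 'e list \<Rightarrow> 'v \<Rightarrow> bool" where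
  "is_path H v [] w \<longleftrightarrow> v \<in> verts H \<and> v = w"
| "is_path H v (e # es) w \<longleftrightarrow> (\<exists>u. traverses H e v u \<and> is_path H u es w)"

definition path_time :: "('e \<Rightarrow> real) \<Rightarrow> 'e list \<Rightarrow> real" where
  "path_time \<tau> es = (\<Sum>e\<leftarrow>es. \<tau> e)"

text \<open>The infimum is taken in the extended reals, so it is \<open>\<infinity>\<close> if there is no path.\<close>

definition passage_time ::
    "('v, 'e) mixed_graph \<Rightarrow> ('e \<Rightarrow> 'o \<Rightarrow> real) \<Rightarrow> 'v \<Rightarrow> 'v \<Rightarrow> 'o \<Rightarrow> ereal" where
  "passage_time H X v w \<omega> = (INF es \<in> {es. is_path H v es w}. ereal (path_time (\<lambda>e. X e \<omega>) es))"

definition iid_edge_times ::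
    "'o measure \<Rightarrow> real measure \<Rightarrow> ('v, 'e) mixed_graph \<Rightarrow> ('e \<Rightarrow> 'o \<Rightarrow> real) \<Rightarrow> bool" where
  "iid_edge_times M F H X \<longleftrightarrow> prob_space M \<and>
     prob_space.indep_vars M (\<lambda>_. borel) X (edges H) \<and>
     (\<forall>e \<in> edges H. distr M borel (X e) = F)"

definition Exp1 :: "real measure" where
  "Exp1 = density lborel (\<lambda>x. ennreal (exponential_density 1 x))"

definition class_C :: "real \<Rightarrow> real measure set" where
  "class_C \<rho> = {F. real_distribution F \<and> measure F {..<0} = 0 \<and>
     ((\<lambda>x. cdf F x / x) \<longlongrightarrow> \<rho>) (at_right 0)}"

definition class_C_L1 :: "real \<Rightarrow> real measure set" where
  "class_C_L1 \<rho> = {F \<in> class_C \<rho>. integrable F (\<lambda>x. x)}"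

text \<open>
  Convergence to a constant of random variables \<open>Y n\<close> that may live on different probability spaces
  \<open>M n\<close> and may take infinite values; note that \<open>\<bar>\<infinity> - c\<bar> = \<infinity>\<close>.
\<close>

definition tendsto_in_prob ::
    "(nat \<Rightarrow> 'o measure) \<Rightarrow> (nat \<Rightarrow> 'o \<Rightarrow> ereal) \<Rightarrow> real \<Rightarrow> bool" where
  "tendsto_in_prob M Y c \<longleftrightarrow> (\<forall>\<epsilon>>0.
     (\<lambda>n. measure (M n) {\<omega> \<in> space (M n). \<bar>Y n \<omega> - ereal c\<bar> > ereal \<epsilon>}) \<longlonglongrightarrow> 0)"

definition tendsto_in_L1 ::
    "(nat \<Rightarrow> 'o measure) \<Rightarrow> (nat \<Rightarrow> 'o \<Rightarrow> ereal) \<Rightarrow> real \<Rightarrow> bool" where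
  "tendsto_in_L1 M Y c \<longleftrightarrow>
     (\<lambda>n. \<integral>\<^sup>+ \<omega>. e2ennreal \<bar>Y n \<omega> - ereal c\<bar> \<partial>M n) \<longlonglongrightarrow> 0"

text \<open>
  First-passage times are measurable, so the probabilities and integrals above are the intended ones.
\<close>

lemma (in bounded_degree_graph) countable_edges: "countable (edges H)"
proof -
  have "edges H \<subseteq> (\<Union>v\<in>verts H. incident_edges H v)"
    using tail_in_verts by (auto simp: incident_edges_def)
  moreover have "countable (\<Union>v\<in>verts H. incident_edges H v)"
    using countable_verts bounded_degree by (blast intro: countable_UN countable_finite)
  ultimately show ?thesis by (rule countable_subset)
qed

lemma is_path_edges: "is_path H v es w \<Longrightarrow> set es \<subseteq> edges H"
  by (induction H v es w rule: is_path.induct) (auto simp: traverses_def)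

lemma (in bounded_degree_graph) borel_measurable_passage_time:
  assumes "iid_edge_times M F H X"
  shows "passage_time H X v w \<in> borel_measurable M"
proof -
  interpret prob_space M using assms by (simp add: iid_edge_times_def)
  have X: "X e \<in> borel_measurable M" if "e \<in> edges H" for e
    using assms that by (auto simp: iid_edge_times_def indep_vars_def)
  have *: "(\<lambda>\<omega>. path_time (\<lambda>e. X e \<omega>) es) \<in> borel_measurable M" if "set es \<subseteq> edges H" for es
    using that unfolding path_time_def by (induction es) (auto intro!: borel_measurable_add X)
  have "{es. is_path H v es w} \<subseteq> lists (edges H)"
    using is_path_edges by fastforce
  then have c: "countable {es. is_path H v es w}"
    using countable_edges countable_lists countable_subset by blast
  show ?thesis
    unfolding passage_time_def
    by (rule borel_measurable_INF[OF c])
      (intro borel_measurable_ereal *, simp add: is_path_edges)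
qed

end

theory Submission
  imports Defs
begin

text \<open>
  Why only the behaviour of \<open>F\<close> at \<open>0\<close> matters.  If \<open>Y\<close> is standard exponential, then
  \<open>q(Y) = F\<^sup>-\<^sup>1(1 - exp(-Y))\<close> has law \<open>F\<close>, and the hypothesis on \<open>F\<close> says that \<open>q(x)\<close> and \<open>x / \<rho>\<close>
  are comparable up to a factor \<open>1 + \<eta>\<close> as long as they are small (\<open>exp_quantile_near_zero\<close>).  Along
  a path all of whose edges are light, the two kinds of passage time therefore agree up to the
  scaling by \<open>\<rho>\<close>.  The whole difficulty is caused by heavy edges, those of weight above a fixed
  \<open>\<delta>\<close>.  A path of total weight \<open>s\<close> contains at most \<open>s / \<delta>\<close> of them, a bound that depends neither on
  the graph nor on the path.

  Heavy edges are removed by sprinkling.  A standard exponential clock is the minimum of two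
  independent clocks of rates \<open>1 - \<eta>\<close> and \<open>\<eta>\<close>.  Hence a standard exponential field can be produced
  from another such field \<open>y\<close> by slowing \<open>y\<close> down by the factor \<open>1 / (1 - \<eta>)\<close> and taking the
  edgewise minimum with an independent field of rate \<open>\<eta>\<close>.  Whatever path and whatever \<open>K\<close> of its
  edges are selected by looking at \<open>y\<close>, the second field lowers the weights of all these edges to at
  most \<open>b\<close> with probability at least \<open>(1 - exp(-b \<eta>))\<^sup>K > 0\<close>.  So if in the field \<open>y\<close>, with
  probability \<open>p\<close>, some path would become shorter than \<open>s\<close> after cheapening \<open>K\<close> of its edges, then
  \<open>p \<le> const \<cdot> P(T < s)\<close> with a constant that does not depend on the graph (\<open>sprinkling\<close>).  This is
  used twice.

  \<^item> \<open>lower_tail\<close>: if a path is shorter than \<open>s'\<close> for the weights \<open>q(y)\<close> and its heavy edges are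
    cheapened, it is shorter than \<open>s\<close>, for any \<open>s > \<rho> s'\<close>.  Hence
    \<open>P(T\<^sub>F < s') \<le> const \<cdot> P(T < s)\<close>, which gives the third claim and one half of the first.

  \<^item> \<open>light_paths\<close>: if \<open>y\<close> has a path of length close to \<open>t\<close> with a heavy edge, then cheapening the
    heavy edges saves at least \<open>\<delta> / 2\<close> and leads below \<open>t - \<delta> / 4\<close>.  When \<open>T\<close> concentrates at
    \<open>t\<close> this is unlikely, so with high probability some path of length close to \<open>t\<close> has no heavy
    edge, and its length for the weights \<open>q(y)\<close> is close to \<open>t / \<rho>\<close>.  This is the other half of
    the first claim.

  For convergence in mean the event that no such light path exists has to be controlled too.  Here
  the heavy weights of \<open>y\<close> are redrawn independently before \<open>q\<close> is applied, which does not change the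
  law of the result.  Given \<open>y\<close>, the expected new length of any path is then at most a constant times
  its length in \<open>y\<close>, since a heavy edge contributes a fixed finite mean.  So on that event \<open>T\<^sub>F\<close> is
  dominated in mean by a multiple of \<open>T\<close> (\<open>upper_tail_mean\<close>), and \<open>T\<close> has negligible mean there.
\<close>

section \<open>Passage times of edge-weight fields\<close>

abbreviation field_time :: "('v, 'e) mixed_graph \<Rightarrow> 'v \<Rightarrow> 'v \<Rightarrow> ('e \<Rightarrow> real) \<Rightarrow> ereal" where
  "field_time H v w \<equiv> passage_time H (\<lambda>e y. y e) v w"

lemma passage_time_eq_field_time: "passage_time H X v w \<omega> = field_time H v w (\<lambda>e. X e \<omega>)"
  by (simp add: passage_time_def)

lemma path_time_cong:
  "(\<And>e. e \<in> set es \<Longrightarrow> f e = g e) \<Longrightarrow> path_time f es = path_time g es"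
  unfolding path_time_def by (auto intro!: arg_cong[where f = sum_list])

lemma path_time_mono:
  "(\<And>e. e \<in> set es \<Longrightarrow> f e \<le> g e) \<Longrightarrow> path_time f es \<le> path_time g es"
  unfolding path_time_def by (rule sum_list_mono)

lemma path_time_nonneg:
  "(\<And>e. e \<in> set es \<Longrightarrow> 0 \<le> f e) \<Longrightarrow> 0 \<le> path_time f es"
  unfolding path_time_def by (rule sum_list_nonneg) auto

lemma path_time_cmult: "path_time (\<lambda>e. c * f e) es = c * path_time f es"
  unfolding path_time_def by (rule sum_list_const_mult)

lemma path_time_add: "path_time (\<lambda>e. f e + g e) es = path_time f es + path_time g es"
  unfolding path_time_def by (rule sum_list_addf)

lemma member_le_path_time:
  assumes "\<And>e. e \<in> set es \<Longrightarrow> 0 \<le> f e" "e \<in> set es"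
  shows "f e \<le> path_time f es"
  using assms unfolding path_time_def by (intro member_le_sum_list) auto

text \<open>The resulting bound on the number of heavy edges does not involve the number of edges of the
  path; this is what makes the constants obtained by sprinkling uniform over all graphs.\<close>

lemma card_heavy_edges_le:
  assumes nonneg: "\<And>e. e \<in> set es \<Longrightarrow> 0 \<le> f e" and J: "J \<subseteq> set es"
    and heavy: "\<And>e. e \<in> J \<Longrightarrow> c \<le> f e"
  shows "c * real (card J) \<le> path_time f es"
proof -
  have "c * real (card J) = (\<Sum>e\<in>J. c)" by simp
  also have "\<dots> \<le> (\<Sum>e\<in>J. f e)" using heavy by (rule sum_mono)
  also have "\<dots> \<le> (\<Sum>e\<in>set es. f e)" using J nonneg by (intro sum_mono2) auto
  also have "\<dots> \<le> path_time f es"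
    using nonneg unfolding path_time_def
  proof (induction es)
    case (Cons e es)
    then have "sum f (set es) \<le> sum_list (map f es)" by simp
    moreover have "sum f (set (e # es)) \<le> f e + sum f (set es)"
      using Cons.prems by (cases "e \<in> set es") (auto simp: insert_absorb)
    ultimately show ?case by simp
  qed simp
  finally show ?thesis .
qed

lemma field_time_less_iff:
  "field_time H v w y < ereal s \<longleftrightarrow> (\<exists>es. is_path H v es w \<and> path_time y es < s)"
  by (auto simp: passage_time_def INF_less_iff)

lemma field_time_cong:
  assumes "\<And>e. e \<in> edges H \<Longrightarrow> f e = g e"
  shows "field_time H v w f = field_time H v w g"
  unfolding passage_time_def
  by (intro INF_cong refl arg_cong[where f = ereal] path_time_cong assms)
    (use is_path_edges[of H v _ w] in auto)

lemma field_time_le: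
  "is_path H v es w \<Longrightarrow> field_time H v w y \<le> ereal (path_time y es)"
  unfolding passage_time_def by (intro INF_lower) simp

lemma field_time_nonneg:
  assumes "\<And>e. e \<in> edges H \<Longrightarrow> 0 \<le> y e"
  shows "0 \<le> field_time H v w y"
  unfolding passage_time_def
proof (intro INF_greatest)
  fix es assume "es \<in> {es. is_path H v es w}"
  then show "0 \<le> ereal (path_time y es)"
    using assms is_path_edges[of H v es w] by (auto intro!: path_time_nonneg)
qed

section \<open>Fields of independent edge weights\<close>

text \<open>Unlike \<open>real_distribution\<close>, this locale provides the infinite products of \<open>F\<close> with itself.\<close>

locale borel_prob = prob_space F for F :: "real measure" +
  assumes sets_F [measurable_cong, simp]: "sets F = sets borel"
begin

lemma space_F [simp]: "space F = UNIV"
  using sets_eq_imp_space_eq[OF sets_F] by simp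

sublocale pps: product_prob_space "\<lambda>_. F" E for E :: "'i set"
  by unfold_locales

lemma measurable_coordinate: "j \<in> E \<Longrightarrow> (\<lambda>y. y j) \<in> borel_measurable (PiM E (\<lambda>_. F))"
  using measurable_component_singleton[of j E "\<lambda>_. F"] by (simp cong: measurable_cong_sets)

end

abbreviation iid_field :: "'e set \<Rightarrow> real measure \<Rightarrow> ('e \<Rightarrow> real) measure" where
  "iid_field E F \<equiv> PiM E (\<lambda>_. F)"

lemma distr_iid_edge_times:
  assumes iid: "iid_edge_times M F H X" and F: "borel_prob F"
  shows "distr M (iid_field (edges H) F) (\<lambda>\<omega>. \<lambda>e\<in>edges H. X e \<omega>) = iid_field (edges H) F"
proof -
  interpret M: prob_space M using iid by (simp add: iid_edge_times_def)
  interpret F: borel_prob F by fact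
  have X: "M.indep_vars (\<lambda>_. borel) X (edges H)"
    and law: "\<And>e. e \<in> edges H \<Longrightarrow> distr M borel (X e) = F"
    using iid by (auto simp: iid_edge_times_def)
  have meas: "\<And>e. e \<in> edges H \<Longrightarrow> X e \<in> borel_measurable M"
    using X by (auto simp: M.indep_vars_def)
  have m: "(\<lambda>\<omega>. \<lambda>e\<in>edges H. X e \<omega>) \<in> measurable M (iid_field (edges H) F)"
    by (rule measurable_restrict) (use meas F.sets_F in \<open>simp cong: measurable_cong_sets\<close>)
  show ?thesis
  proof (rule F.pps.PiM_eq)
    fix J A
    assume J: "finite J" "J \<subseteq> edges H" and A: "\<And>j. j \<in> J \<Longrightarrow> A j \<in> sets F"
    have pre: "(\<lambda>\<omega>. \<lambda>e\<in>edges H. X e \<omega>) -` prod_emb (edges H) (\<lambda>_. F) J (Pi\<^sub>E J A) \<inter> space M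
        = {\<omega>\<in>space M. \<forall>j\<in>J. X j \<omega> \<in> A j}"
      using J(2) by (fastforce simp: prod_emb_def PiE_iff Pi_iff extensional_def)
    have "emeasure (distr M (iid_field (edges H) F) (\<lambda>\<omega>. \<lambda>e\<in>edges H. X e \<omega>))
        (prod_emb (edges H) (\<lambda>_. F) J (Pi\<^sub>E J A)) = emeasure M {\<omega>\<in>space M. \<forall>j\<in>J. X j \<omega> \<in> A j}"
      using m J A by (subst emeasure_distr) (auto intro!: sets_PiM_I simp: pre)
    also have "\<dots> = (\<Prod>j\<in>J. emeasure F (A j))"
    proof (cases "J = {}")
      case False
      have "{\<omega>\<in>space M. \<forall>j\<in>J. X j \<omega> \<in> A j} = (\<Inter>j\<in>J. X j -` A j \<inter> space M)"
        using False by auto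
      then have "emeasure M {\<omega>\<in>space M. \<forall>j\<in>J. X j \<omega> \<in> A j}
          = (\<Prod>j\<in>J. emeasure M (X j -` A j \<inter> space M))"
        using M.indep_varsD[OF X False J(1,2), of A] A
        by (simp add: M.emeasure_eq_measure prod_ennreal)
      also have "\<dots> = (\<Prod>j\<in>J. emeasure F (A j))"
      proof (rule prod.cong[OF refl])
        fix j assume j: "j \<in> J"
        have "emeasure F (A j) = emeasure (distr M borel (X j)) (A j)"
          using law j J(2) by auto
        also have "\<dots> = emeasure M (X j -` A j \<inter> space M)"
          using meas A j J(2) by (subst emeasure_distr) auto
        finally show "emeasure M (X j -` A j \<inter> space M) = emeasure F (A j)" ..
      qed
      finally show ?thesis .
    qed (simp add: M.emeasure_space_1)
    finally show "emeasure (distr M (iid_field (edges H) F) (\<lambda>\<omega>. \<lambda>e\<in>edges H. X e \<omega>))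
        (prod_emb (edges H) (\<lambda>_. F) J (Pi\<^sub>E J A)) = (\<Prod>j\<in>J. emeasure F (A j))" .
  qed simp
qed

lemma (in bounded_degree_graph) measurable_field_time [measurable]:
  assumes "borel_prob F"
  shows "field_time H v w \<in> borel_measurable (iid_field (edges H) F)"
proof -
  interpret F: borel_prob F by fact
  have *: "(\<lambda>y. path_time y es) \<in> borel_measurable (iid_field (edges H) F)" if "set es \<subseteq> edges H" for es
    using that unfolding path_time_def by (induction es) (auto intro!: borel_measurable_add F.measurable_coordinate)
  have "{es. is_path H v es w} \<subseteq> lists (edges H)"
    using is_path_edges by fastforce
  then have c: "countable {es. is_path H v es w}"
    using countable_edges countable_lists countable_subset by blast
  show ?thesis
    unfolding passage_time_def
    by (rule borel_measurable_INF[OF c])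
      (intro borel_measurable_ereal *, simp add: is_path_edges)
qed

text \<open>All claims depend only on the laws of the passage times, so the given probability spaces may be
  replaced by products of copies of \<open>F\<close> indexed by the edges.\<close>

lemma (in bounded_degree_graph) distr_passage_time:
  assumes iid: "iid_edge_times M F H X" and F: "borel_prob F"
  shows "distr M borel (passage_time H X v w)
    = distr (iid_field (edges H) F) borel (field_time H v w)"
proof -
  interpret F: borel_prob F by fact
  have meas: "\<And>e. e \<in> edges H \<Longrightarrow> X e \<in> borel_measurable M"
    using iid by (auto simp: iid_edge_times_def prob_space.indep_vars_def)
  have m: "(\<lambda>\<omega>. \<lambda>e\<in>edges H. X e \<omega>) \<in> measurable M (iid_field (edges H) F)"
    by (rule measurable_restrict) (use meas F.sets_F in \<open>simp cong: measurable_cong_sets\<close>)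
  have "distr (iid_field (edges H) F) borel (field_time H v w)
      = distr M borel (field_time H v w \<circ> (\<lambda>\<omega>. \<lambda>e\<in>edges H. X e \<omega>))"
    using m measurable_field_time[OF F]
    by (subst distr_iid_edge_times[OF iid F, symmetric]) (rule distr_distr)
  also have "field_time H v w \<circ> (\<lambda>\<omega>. \<lambda>e\<in>edges H. X e \<omega>) = passage_time H X v w"
    by (auto simp: fun_eq_iff passage_time_eq_field_time[of H X] intro!: field_time_cong)
  finally show ?thesis ..
qed

lemma (in bounded_degree_graph) measurable_field_time_map:
  assumes A: "borel_prob A" and h [measurable]: "h \<in> borel_measurable borel"
  shows "(\<lambda>y. field_time H v w (\<lambda>e. h (y e))) \<in> borel_measurable (iid_field (edges H) A)"
proof -
  interpret A: borel_prob A by fact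
  have c: "(\<lambda>y. h (y e)) \<in> borel_measurable (iid_field (edges H) A)" if "e \<in> edges H" for e
    using A.measurable_coordinate[OF that] h by (rule measurable_compose)
  have m: "(\<lambda>y. \<lambda>e\<in>edges H. h (y e)) \<in> measurable (iid_field (edges H) A) (iid_field (edges H) A)"
    by (rule measurable_restrict) (use c in \<open>simp cong: measurable_cong_sets\<close>)
  have "(\<lambda>y. field_time H v w (\<lambda>e\<in>edges H. h (y e))) \<in> borel_measurable (iid_field (edges H) A)"
    using m measurable_field_time[OF A] by (rule measurable_compose)
  moreover have "field_time H v w (\<lambda>e\<in>edges H. h (y e)) = field_time H v w (\<lambda>e. h (y e))" for y
    by (rule field_time_cong) simp
  ultimately show ?thesis by simp
qed

definition prob_field_time_less ::
    "real measure \<Rightarrow> ('v, 'e) mixed_graph \<Rightarrow> 'v \<Rightarrow> 'v \<Rightarrow> real \<Rightarrow> real" where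
  "prob_field_time_less F H v w s =
     measure (iid_field (edges H) F) {y \<in> space (iid_field (edges H) F). field_time H v w y < ereal s}"

lemma prob_field_time_less_bounds:
  assumes "borel_prob F"
  shows "0 \<le> prob_field_time_less F H v w s" "prob_field_time_less F H v w s \<le> 1"
proof -
  interpret F: borel_prob F by fact
  show "0 \<le> prob_field_time_less F H v w s" "prob_field_time_less F H v w s \<le> 1"
    unfolding prob_field_time_less_def by (auto intro: F.pps.prob_le_1)
qed

lemma (in bounded_degree_graph) measure_passage_time_less:
  assumes iid: "iid_edge_times M F H X" and F: "borel_prob F"
  shows "measure M {\<omega> \<in> space M. passage_time H X v w \<omega> < ereal s} = prob_field_time_less F H v w s"
proof -
  have "measure M {\<omega> \<in> space M. passage_time H X v w \<omega> < ereal s}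
      = measure (distr M borel (passage_time H X v w)) {..<ereal s}"
    by (subst measure_distr[OF borel_measurable_passage_time[OF iid]])
      (auto intro!: arg_cong[where f = "measure M"])
  also have "\<dots> = prob_field_time_less F H v w s"
    unfolding distr_passage_time[OF iid F] prob_field_time_less_def
    by (subst measure_distr[OF measurable_field_time[OF F]]) (auto intro!: arg_cong2[where f = measure])
  finally show ?thesis .
qed

lemma (in bounded_degree_graph) nn_integral_passage_time:
  assumes iid: "iid_edge_times M F H X" and F: "borel_prob F" and g: "g \<in> borel_measurable borel"
  shows "(\<integral>\<^sup>+\<omega>. g (passage_time H X v w \<omega>) \<partial>M) = (\<integral>\<^sup>+y. g (field_time H v w y) \<partial>iid_field (edges H) F)"
proof -
  have "(\<integral>\<^sup>+\<omega>. g (passage_time H X v w \<omega>) \<partial>M) = (\<integral>\<^sup>+r. g r \<partial>distr M borel (passage_time H X v w))"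
    using g by (subst nn_integral_distr[OF borel_measurable_passage_time[OF iid]]) auto
  also have "\<dots> = (\<integral>\<^sup>+y. g (field_time H v w y) \<partial>iid_field (edges H) F)"
    unfolding distr_passage_time[OF iid F]
    using g by (subst nn_integral_distr[OF measurable_field_time[OF F]]) auto
  finally show ?thesis .
qed

text \<open>The law of finitely many coordinates is a finite product even if \<open>E\<close> is infinite, and for finite
  products the formula is Fubini's theorem.\<close>

lemma (in borel_prob) nn_integral_iid_field_prod:
  assumes J: "finite J" "J \<subseteq> E" and f [measurable]: "\<And>j. j \<in> J \<Longrightarrow> f j \<in> borel_measurable borel"
  shows "(\<integral>\<^sup>+y. (\<Prod>j\<in>J. f j (y j)) \<partial>iid_field E F) = (\<Prod>j\<in>J. \<integral>\<^sup>+x. f j x \<partial>F)"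
proof -
  have mJ: "(\<lambda>y. f j (y j)) \<in> borel_measurable (iid_field J F)" if "j \<in> J" for j
    using measurable_coordinate[OF that] f[OF that] by (rule measurable_compose)
  have "(\<integral>\<^sup>+y. (\<Prod>j\<in>J. f j (y j)) \<partial>iid_field E F)
      = (\<integral>\<^sup>+y. (\<Prod>j\<in>J. f j (restrict y J j)) \<partial>iid_field E F)"
    by (intro nn_integral_cong prod.cong) auto
  also have "\<dots> = (\<integral>\<^sup>+y. (\<Prod>j\<in>J. f j (y j)) \<partial>distr (iid_field E F) (iid_field J F) (\<lambda>y. restrict y J))"
    by (subst nn_integral_distr)
      (auto intro!: borel_measurable_prod_ennreal mJ measurable_restrict_subset J)
  also have "\<dots> = (\<integral>\<^sup>+y. (\<Prod>j\<in>J. f j (y j)) \<partial>iid_field J F)"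
    using J by (subst pps.distr_PiM_restrict_finite) auto
  also have "\<dots> = (\<Prod>j\<in>J. \<integral>\<^sup>+x. f j x \<partial>F)"
    using J(1) f by (subst pps.product_nn_integral_prod) auto
  finally show ?thesis .
qed

lemma measurable_coupled_field:
  assumes A: "borel_prob A" and B: "borel_prob B" and C: "borel_prob C"
    and \<phi> [measurable]: "case_prod \<phi> \<in> borel_measurable (borel \<Otimes>\<^sub>M borel)"
  shows "j \<in> E \<Longrightarrow> (\<lambda>p. \<phi> (fst p j) (snd p j)) \<in> borel_measurable (iid_field E A \<Otimes>\<^sub>M iid_field E B)"
    and "(\<lambda>(y, z). \<lambda>e\<in>E. \<phi> (y e) (z e))
      \<in> measurable (iid_field E A \<Otimes>\<^sub>M iid_field E B) (iid_field E C)"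
proof -
  interpret A: borel_prob A by fact
  interpret B: borel_prob B by fact
  interpret C: borel_prob C by fact
  note [measurable] = A.measurable_coordinate B.measurable_coordinate
  show *: "(\<lambda>p. \<phi> (fst p j) (snd p j)) \<in> borel_measurable (iid_field E A \<Otimes>\<^sub>M iid_field E B)"
    if "j \<in> E" for j
    using that by measurable
  show "(\<lambda>(y, z). \<lambda>e\<in>E. \<phi> (y e) (z e))
      \<in> measurable (iid_field E A \<Otimes>\<^sub>M iid_field E B) (iid_field E C)"
    unfolding case_prod_beta
    by (rule measurable_restrict) (use * in \<open>simp cong: measurable_cong_sets\<close>)
qed

text \<open>Every edge of the new field looks only at the weights of the same edge in the two independent
  fields, so different edges do not interact.  By Fubini and the product formula above, the
  probability of a finite cylinder factorises, and its factors are governed by the law on a single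
  edge.\<close>

lemma distr_coupled_field:
  assumes A: "borel_prob A" and B: "borel_prob B"
    and \<phi> [measurable]: "case_prod \<phi> \<in> borel_measurable (borel \<Otimes>\<^sub>M borel)"
    and law: "distr (A \<Otimes>\<^sub>M B) borel (case_prod \<phi>) = C"
  shows "distr (iid_field E A \<Otimes>\<^sub>M iid_field E B) (iid_field E C) (\<lambda>(y, z). \<lambda>e\<in>E. \<phi> (y e) (z e))
    = iid_field E C"
proof -
  interpret A: borel_prob A by fact
  interpret B: borel_prob B by fact
  interpret AB: pair_prob_space A B ..
  have [measurable]: "case_prod \<phi> \<in> borel_measurable (A \<Otimes>\<^sub>M B)" by simp
  have sC [measurable_cong, simp]: "sets C = sets borel" using law by auto
  interpret C: borel_prob C
    using AB.prob_space_distr[of "case_prod \<phi>" borel] law sC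
    by (auto simp: borel_prob_def borel_prob_axioms_def)
  let ?P = "iid_field E A \<Otimes>\<^sub>M iid_field E B"
  have sfB: "sigma_finite_measure (iid_field E B)"
    by (intro prob_space_imp_sigma_finite prob_space_PiM B.prob_space_axioms)
  note \<phi>e = measurable_coupled_field(1)[OF A B C.borel_prob_axioms \<phi>]
    and m = measurable_coupled_field(2)[OF A B C.borel_prob_axioms \<phi>, of E]
  show ?thesis
  proof (rule C.pps.PiM_eq)
    fix J S
    assume J: "finite J" "J \<subseteq> E" and S: "\<And>j. j \<in> J \<Longrightarrow> S j \<in> sets C"
    have Sb [measurable]: "S j \<in> sets borel" if "j \<in> J" for j using S[OF that] by simp
    have ind: "(\<lambda>p. indicator (S j) (\<phi> (fst p j) (snd p j)) :: ennreal) \<in> borel_measurable ?P"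
      if "j \<in> J" for j
      using measurable_compose[OF \<phi>e borel_measurable_indicator[OF Sb]] that J by auto
    have in2: "(\<lambda>x. \<integral>\<^sup>+z. indicator (S j) (\<phi> x z) \<partial>B) \<in> borel_measurable A" if "j \<in> J" for j
      using that by measurable
    have "emeasure (distr ?P (iid_field E C) (\<lambda>(y, z). \<lambda>e\<in>E. \<phi> (y e) (z e)))
        (prod_emb E (\<lambda>_. C) J (Pi\<^sub>E J S))
      = emeasure ?P ((\<lambda>(y, z). \<lambda>e\<in>E. \<phi> (y e) (z e)) -` prod_emb E (\<lambda>_. C) J (Pi\<^sub>E J S) \<inter> space ?P)"
      using m J S by (intro emeasure_distr) (auto intro!: sets_PiM_I)
    also have "\<dots> = (\<integral>\<^sup>+p. indicator ((\<lambda>(y, z). \<lambda>e\<in>E. \<phi> (y e) (z e)) -` prod_emb E (\<lambda>_. C) J (Pi\<^sub>E J S) \<inter> space ?P) p \<partial>?P)"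
      using m J S by (intro nn_integral_indicator[symmetric] measurable_sets[OF m]) (auto intro!: sets_PiM_I)
    also have "\<dots> = (\<integral>\<^sup>+p. (\<Prod>j\<in>J. indicator (S j) (\<phi> (fst p j) (snd p j))) \<partial>?P)"
    proof (rule nn_integral_cong)
      fix p assume p: "p \<in> space ?P"
      have "p \<in> (\<lambda>(y, z). \<lambda>e\<in>E. \<phi> (y e) (z e)) -` prod_emb E (\<lambda>_. C) J (Pi\<^sub>E J S) \<inter> space ?P
          \<longleftrightarrow> (\<forall>j\<in>J. \<phi> (fst p j) (snd p j) \<in> S j)"
        using J p by (auto simp: prod_emb_def PiE_iff Pi_iff extensional_def split: prod.splits)
      then show "indicator ((\<lambda>(y, z). \<lambda>e\<in>E. \<phi> (y e) (z e)) -` prod_emb E (\<lambda>_. C) J (Pi\<^sub>E J S) \<inter> space ?P) p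
          = (\<Prod>j\<in>J. indicator (S j) (\<phi> (fst p j) (snd p j)) :: ennreal)"
        using J(1) by (auto simp: indicator_def prod_zero_iff)
    qed
    also have "\<dots> = (\<integral>\<^sup>+y. \<integral>\<^sup>+z. (\<Prod>j\<in>J. indicator (S j) (\<phi> (y j) (z j))) \<partial>iid_field E B \<partial>iid_field E A)"
      by (subst sigma_finite_measure.nn_integral_fst[OF sfB, symmetric]) (auto intro!: borel_measurable_prod_ennreal ind)
    also have "\<dots> = (\<integral>\<^sup>+y. (\<Prod>j\<in>J. \<integral>\<^sup>+z. indicator (S j) (\<phi> (y j) z) \<partial>B) \<partial>iid_field E A)"
    proof (intro nn_integral_cong B.nn_integral_iid_field_prod J)
      fix y j assume j: "j \<in> J"
      show "(\<lambda>z. indicator (S j) (\<phi> (y j) z) :: ennreal) \<in> borel_measurable borel"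
        using j by measurable
    qed
    also have "\<dots> = (\<Prod>j\<in>J. \<integral>\<^sup>+x. \<integral>\<^sup>+z. indicator (S j) (\<phi> x z) \<partial>B \<partial>A)"
      by (intro A.nn_integral_iid_field_prod J) (use in2 in \<open>simp cong: measurable_cong_sets\<close>)
    also have "\<dots> = (\<Prod>j\<in>J. emeasure C (S j))"
    proof (rule prod.cong[OF refl])
      fix j assume j [measurable]: "j \<in> J"
      have "(\<integral>\<^sup>+x. \<integral>\<^sup>+z. indicator (S j) (\<phi> x z) \<partial>B \<partial>A)
          = (\<integral>\<^sup>+p. indicator (S j) (case_prod \<phi> p) \<partial>(A \<Otimes>\<^sub>M B))"
        by (subst B.nn_integral_fst[symmetric]) auto
      also have "\<dots> = (\<integral>\<^sup>+c. indicator (S j) c \<partial>C)"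
        by (subst law[symmetric], subst nn_integral_distr) auto
      also have "\<dots> = emeasure C (S j)"
        by simp
      finally show "(\<integral>\<^sup>+x. \<integral>\<^sup>+z. indicator (S j) (\<phi> x z) \<partial>B \<partial>A) = emeasure C (S j)" .
    qed
    finally show "emeasure (distr ?P (iid_field E C) (\<lambda>(y, z). \<lambda>e\<in>E. \<phi> (y e) (z e)))
        (prod_emb E (\<lambda>_. C) J (Pi\<^sub>E J S)) = (\<Prod>j\<in>J. emeasure C (S j))" .
  qed simp
qed

text \<open>The iterated integral is the form in which couplings are used below: for fixed \<open>y\<close> one may pick a
  path that is good for \<open>y\<close> and integrate over the independent field \<open>z\<close> alone, which
  avoids a measurable selection of the path.\<close>

lemma (in bounded_degree_graph) nn_integral_coupled_field_time:
  assumes A: "borel_prob A" and B: "borel_prob B" and C: "borel_prob C"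
    and \<phi> [measurable]: "case_prod \<phi> \<in> borel_measurable (borel \<Otimes>\<^sub>M borel)"
    and law: "distr (A \<Otimes>\<^sub>M B) borel (case_prod \<phi>) = C"
    and g [measurable]: "g \<in> borel_measurable borel"
  shows "(\<integral>\<^sup>+x. g (field_time H v w x) \<partial>iid_field (edges H) C)
    = (\<integral>\<^sup>+y. \<integral>\<^sup>+z. g (field_time H v w (\<lambda>e. \<phi> (y e) (z e))) \<partial>iid_field (edges H) B \<partial>iid_field (edges H) A)"
proof -
  interpret A: borel_prob A by fact
  interpret B: borel_prob B by fact
  interpret C: borel_prob C by fact
  let ?E = "edges H"
  let ?P = "iid_field ?E A \<Otimes>\<^sub>M iid_field ?E B"
  let ?X = "\<lambda>(y, z). \<lambda>e\<in>?E. \<phi> (y e) (z e)"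
  have sfB: "sigma_finite_measure (iid_field ?E B)"
    by (intro prob_space_imp_sigma_finite prob_space_PiM B.prob_space_axioms)
  note m = measurable_coupled_field(2)[OF A B C \<phi>, of ?E]
  have gT: "(\<lambda>x. g (field_time H v w x)) \<in> borel_measurable (iid_field ?E C)"
    using measurable_field_time[OF C] g by (rule measurable_compose)
  have eq: "g (field_time H v w (?X p)) = g (field_time H v w (\<lambda>e. \<phi> (fst p e) (snd p e)))" for p
    by (auto intro!: arg_cong[where f = g] field_time_cong split: prod.splits)
  have gX: "(\<lambda>p. g (field_time H v w (\<lambda>e. \<phi> (fst p e) (snd p e)))) \<in> borel_measurable ?P"
    using measurable_compose[OF m gT] by (simp add: eq)
  have "(\<integral>\<^sup>+x. g (field_time H v w x) \<partial>iid_field ?E C)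
      = (\<integral>\<^sup>+p. g (field_time H v w (\<lambda>e. \<phi> (fst p e) (snd p e))) \<partial>?P)"
    by (subst distr_coupled_field[OF A B \<phi> law, symmetric], subst nn_integral_distr[OF m])
      (use gT in \<open>simp_all add: eq\<close>)
  also have "\<dots> = (\<integral>\<^sup>+y. \<integral>\<^sup>+z. g (field_time H v w (\<lambda>e. \<phi> (y e) (z e))) \<partial>iid_field ?E B \<partial>iid_field ?E A)"
    by (subst sigma_finite_measure.nn_integral_fst[OF sfB gX, symmetric]) simp
  finally show ?thesis .
qed

section \<open>Exponential edge weights\<close>

definition exp_law :: "real \<Rightarrow> real measure" where
  "exp_law l = density lborel (\<lambda>x. ennreal (exponential_density l x))"

lemma Exp1_eq_exp_law: "Exp1 = exp_law 1"
  by (simp add: Exp1_def exp_law_def)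

lemma borel_prob_exp_law: "0 < l \<Longrightarrow> borel_prob (exp_law l)"
  by (simp add: borel_prob_def borel_prob_axioms_def exp_law_def prob_space_exponential_density)

lemma borel_prob_Exp1: "borel_prob Exp1"
  by (simp add: Exp1_eq_exp_law borel_prob_exp_law)

lemma measure_exp_law_atMost:
  assumes "0 < l" "0 \<le> a"
  shows "measure (exp_law l) {..a} = 1 - exp (- (a * l))"
proof -
  interpret borel_prob "exp_law l" using assms(1) by (rule borel_prob_exp_law)
  have "distributed (exp_law l) lborel (\<lambda>x. x) (exponential_density l)"
    unfolding distributed_def
    by (auto simp: exp_law_def distr_id2 cong: measurable_cong_sets)
  with assms show ?thesis
    by (auto simp: exponential_distributed_iff atMost_def)
qed

lemma measure_exp_law_greaterThan:
  assumes "0 < l" "0 \<le> a"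
  shows "measure (exp_law l) {a<..} = exp (- (a * l))"
proof -
  interpret borel_prob "exp_law l" using assms(1) by (rule borel_prob_exp_law)
  have "{a<..} = space (exp_law l) - {..a}" by auto
  then show ?thesis
    using prob_compl[of "{..a}"] measure_exp_law_atMost[OF assms] by simp
qed

lemma AE_exp_law_pos: "0 < l \<Longrightarrow> AE x in exp_law l. 0 < x"
  unfolding exp_law_def
  by (subst AE_density)
    (use AE_lborel_singleton[of "0::real"] in \<open>auto simp: exponential_density_def elim!: eventually_mono split: if_splits\<close>)

text \<open>The distribution function on \<open>[0, \<infinity>)\<close> determines an exponential law, since its value at \<open>0\<close>
  leaves no mass for the negative half-line.\<close>

lemma distr_eq_exp_law:
  assumes "prob_space P" "0 < l" and X: "X \<in> borel_measurable P"
    and "\<And>a. 0 \<le> a \<Longrightarrow> measure P {x \<in> space P. X x \<le> a} = 1 - exp (- (a * l))"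
  shows "distr P borel X = exp_law l"
proof -
  interpret prob_space P by fact
  have "distributed P lborel X (exponential_density l)"
    using assms by (subst exponential_distributed_iff) auto
  then have "distr P lborel X = exp_law l"
    by (auto simp: distributed_def exp_law_def)
  moreover have "distr P borel X = distr P lborel X"
    by (rule distr_cong) auto
  ultimately show ?thesis by simp
qed

lemma measure_Exp1:
  shows "0 \<le> a \<Longrightarrow> measure Exp1 {..a} = 1 - exp (- a)"
    and "0 \<le> a \<Longrightarrow> measure Exp1 {a<..} = exp (- a)"
    and "measure Exp1 UNIV = 1"
proof -
  interpret borel_prob Exp1 by (rule borel_prob_Exp1)
  show "measure Exp1 UNIV = 1" using prob_space by simp
qed (simp_all add: Exp1_eq_exp_law measure_exp_law_atMost measure_exp_law_greaterThan)

lemma measure_pair_Times: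
  assumes "borel_prob A" "borel_prob B" "S \<in> sets borel" "T \<in> sets borel"
  shows "measure (A \<Otimes>\<^sub>M B) (S \<times> T) = measure A S * measure B T"
proof -
  interpret A: borel_prob A by fact
  interpret B: borel_prob B by fact
  show ?thesis
    using assms by (simp add: measure_def B.emeasure_pair_measure_Times enn2real_mult)
qed

lemma AE_Exp1_pos: "AE x in Exp1. 0 < x"
  unfolding Exp1_eq_exp_law by (rule AE_exp_law_pos) simp

lemma AE_iid_Exp1_pos:
  assumes "countable E"
  shows "AE y in iid_field E Exp1. \<forall>e\<in>E. 0 < y e"
  using assms borel_prob_Exp1 AE_Exp1_pos
  by (subst AE_ball_countable)
    (auto intro!: AE_PiM_component[where P = "\<lambda>x. 0 < x"] simp: borel_prob_def)

text \<open>An exponential clock of rate \<open>1\<close> is the first ring of two independent clocks of rates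
  \<open>1 - \<eta>\<close> and \<open>\<eta>\<close>.\<close>

lemma distr_min_exponential:
  assumes \<eta>: "0 < \<eta>" "\<eta> < 1"
  shows "distr (Exp1 \<Otimes>\<^sub>M exp_law \<eta>) borel (\<lambda>(x, z). min (x / (1 - \<eta>)) z) = Exp1"
proof -
  interpret A: borel_prob Exp1 by (rule borel_prob_Exp1)
  interpret B: borel_prob "exp_law \<eta>" using \<eta>(1) by (rule borel_prob_exp_law)
  interpret AB: pair_prob_space Exp1 "exp_law \<eta>" ..
  let ?P = "Exp1 \<Otimes>\<^sub>M exp_law \<eta>"
  have [measurable]: "(\<lambda>(x, z). min (x / (1 - \<eta>)) z) \<in> borel_measurable ?P"
    by measurable
  have "measure ?P {p \<in> space ?P. (\<lambda>(x, z). min (x / (1 - \<eta>)) z) p \<le> a} = 1 - exp (- (a * 1))"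
    if a: "0 \<le> a" for a
  proof -
    let ?B = "{a * (1 - \<eta>)<..} \<times> {a<..}"
    have B: "{p \<in> space ?P. (\<lambda>(x, z). min (x / (1 - \<eta>)) z) p \<le> a} = space ?P - ?B"
      using \<eta> by (auto simp: space_pair_measure min_le_iff_disj pos_divide_le_eq not_less)
    have "measure ?P ?B = measure Exp1 {a * (1 - \<eta>)<..} * measure (exp_law \<eta>) {a<..}"
      by (intro measure_pair_Times A.borel_prob_axioms B.borel_prob_axioms) auto
    also have "\<dots> = exp (- (a * (1 - \<eta>))) * exp (- (a * \<eta>))"
      using a \<eta> by (simp add: measure_exp_law_greaterThan measure_Exp1)
    also have "\<dots> = exp (- (a * 1))"
      by (simp add: mult_exp_exp algebra_simps)
    finally show ?thesis
      by (subst B, subst AB.prob_compl) auto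
  qed
  then show ?thesis
    unfolding Exp1_eq_exp_law[symmetric]
    by (subst (2) Exp1_eq_exp_law, intro distr_eq_exp_law AB.prob_space_axioms) auto
qed

text \<open>Lack of memory: above the level \<open>\<delta>\<close> the excess may be replaced by an independent copy.\<close>

lemma distr_resample_above:
  assumes \<delta>: "0 < \<delta>"
  shows "distr (Exp1 \<Otimes>\<^sub>M Exp1) borel (\<lambda>(x, z). if x \<le> \<delta> then x else \<delta> + z) = Exp1"
proof -
  interpret A: borel_prob Exp1 by (rule borel_prob_Exp1)
  interpret AB: pair_prob_space Exp1 Exp1 ..
  let ?P = "Exp1 \<Otimes>\<^sub>M Exp1"
  have [measurable]: "(\<lambda>(x, z). if x \<le> \<delta> then x else \<delta> + z) \<in> borel_measurable ?P"
    by measurable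
  have Times: "measure ?P (S \<times> T) = measure Exp1 S * measure Exp1 T"
    if "S \<in> sets borel" "T \<in> sets borel" for S T
    using that by (intro measure_pair_Times A.borel_prob_axioms) auto
  have "measure ?P {p \<in> space ?P. (\<lambda>(x, z). if x \<le> \<delta> then x else \<delta> + z) p \<le> a} = 1 - exp (- (a * 1))"
    if a: "0 \<le> a" for a
  proof (cases "a < \<delta>")
    case True
    have nn: "AE p in ?P. 0 < snd p"
    proof (rule AB.AE_pair_measure)
      show "{p \<in> space ?P. 0 < snd p} \<in> sets ?P" by measurable
      show "AE x in Exp1. AE y in Exp1. 0 < snd (x, y)"
        using AE_Exp1_pos by simp
    qed
    have "measure ?P {p \<in> space ?P. (\<lambda>(x, z). if x \<le> \<delta> then x else \<delta> + z) p \<le> a}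
        = measure ?P ({..a} \<times> UNIV)"
    proof (rule AB.finite_measure_eq_AE)
      show "AE p in ?P. (p \<in> {p \<in> space ?P. (\<lambda>(x, z). if x \<le> \<delta> then x else \<delta> + z) p \<le> a})
          = (p \<in> {..a} \<times> UNIV)"
        using nn by eventually_elim (use True in \<open>auto simp: space_pair_measure split: if_splits\<close>)
    qed measurable
    also have "\<dots> = 1 - exp (- (a * 1))"
      using a by (simp add: Times measure_Exp1)
    finally show ?thesis .
  next
    case False
    have "{p \<in> space ?P. (\<lambda>(x, z). if x \<le> \<delta> then x else \<delta> + z) p \<le> a}
        = {..\<delta>} \<times> UNIV \<union> {\<delta><..} \<times> {..a - \<delta>}"
      using False by (auto simp: space_pair_measure split: if_splits)
    also have "measure ?P \<dots> = measure ?P ({..\<delta>} \<times> UNIV) + measure ?P ({\<delta><..} \<times> {..a - \<delta>})"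
      by (rule AB.finite_measure_Union) auto
    also have "\<dots> = (1 - exp (- \<delta>)) + exp (- \<delta>) * (1 - exp (- (a - \<delta>)))"
      using False \<delta> by (simp add: Times measure_Exp1)
    also have "\<dots> = 1 - exp (- (a * 1))"
      by (simp add: right_diff_distrib mult_exp_exp)
    finally show ?thesis .
  qed
  then show ?thesis
    unfolding Exp1_eq_exp_law[symmetric]
    by (subst (3) Exp1_eq_exp_law, intro distr_eq_exp_law AB.prob_space_axioms) auto
qed

section \<open>Sprinkling\<close>

text \<open>The standard exponential field is realised as the minimum of \<open>y / (1 - \<eta>)\<close> and an independent
  field \<open>z\<close> of rate \<open>\<eta>\<close>.  If \<open>y \<in> A\<close>, then on the event that \<open>z \<le> b\<close> on \<open>J\<close>, which has
  conditional probability at least \<open>(1 - exp(-b \<eta>))\<^sup>K\<close>, the passage time of the minimum is less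
  than \<open>s\<close>.  The path and the set \<open>J\<close> may depend on \<open>y\<close> in any way.\<close>

lemma (in bounded_degree_graph) sprinkling:
  assumes \<eta>: "0 < \<eta>" "\<eta> < 1" and b: "0 \<le> b"
    and A [measurable]: "A \<in> sets (iid_field (edges H) Exp1)"
    and good: "AE y in iid_field (edges H) Exp1. y \<in> A \<longrightarrow>
      (\<exists>es J. is_path H v es w \<and> J \<subseteq> set es \<and> card J \<le> K \<and>
         path_time (\<lambda>e. if e \<in> J then b else y e / (1 - \<eta>)) es < s)"
  shows "measure (iid_field (edges H) Exp1) A * (1 - exp (- (b * \<eta>))) ^ K
    \<le> measure (iid_field (edges H) Exp1)
        {y \<in> space (iid_field (edges H) Exp1). field_time H v w y < ereal s}"
proof -
  let ?E = "edges H" let ?\<mu> = "iid_field (edges H) Exp1" let ?\<nu> = "iid_field (edges H) (exp_law \<eta>)"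
  let ?T = "field_time H v w"
  let ?\<phi> = "\<lambda>x z :: real. min (x / (1 - \<eta>)) z"
  define p where "p = 1 - exp (- (b * \<eta>))"
  have p: "0 \<le> p" "p \<le> 1" using \<eta> b by (auto simp: p_def)
  interpret A: borel_prob Exp1 by (rule borel_prob_Exp1)
  interpret B: borel_prob "exp_law \<eta>" using \<eta>(1) by (rule borel_prob_exp_law)
  have [measurable]: "?T \<in> borel_measurable ?\<mu>" by (rule measurable_field_time[OF borel_prob_Exp1])
  have \<phi>: "case_prod ?\<phi> \<in> borel_measurable (borel \<Otimes>\<^sub>M borel)" by measurable
  note coup = nn_integral_coupled_field_time[OF borel_prob_Exp1 borel_prob_exp_law[OF \<eta>(1)] borel_prob_Exp1
      \<phi> distr_min_exponential[OF \<eta>],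
      where g = "indicator {..<ereal s}" and v = v and w = w, simplified]
  have "emeasure ?\<mu> {y \<in> space ?\<mu>. ?T y < ereal s} = (\<integral>\<^sup>+y. indicator {y \<in> space ?\<mu>. ?T y < ereal s} y \<partial>?\<mu>)"
    by (subst nn_integral_indicator) auto
  also have "\<dots> = (\<integral>\<^sup>+y. indicator {..<ereal s} (?T y) \<partial>?\<mu>)"
    by (intro nn_integral_cong) (auto simp: indicator_def)
  also have "\<dots> = (\<integral>\<^sup>+y. \<integral>\<^sup>+z. indicator {..<ereal s} (?T (\<lambda>e. ?\<phi> (y e) (z e))) \<partial>?\<nu> \<partial>?\<mu>)"
    by (rule coup)
  also have "\<dots> \<ge> (\<integral>\<^sup>+y. ennreal (p ^ K) * indicator A y \<partial>?\<mu>)"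
  proof (rule nn_integral_mono_AE)
    show "AE y in ?\<mu>. ennreal (p ^ K) * indicator A y
        \<le> (\<integral>\<^sup>+z. indicator {..<ereal s} (?T (\<lambda>e. ?\<phi> (y e) (z e))) \<partial>?\<nu>)"
      using good
    proof eventually_elim
      fix y
      assume y: "y \<in> A \<longrightarrow> (\<exists>es J. is_path H v es w \<and> J \<subseteq> set es \<and> card J \<le> K \<and>
         path_time (\<lambda>e. if e \<in> J then b else y e / (1 - \<eta>)) es < s)"
      show "ennreal (p ^ K) * indicator A y
        \<le> (\<integral>\<^sup>+z. indicator {..<ereal s} (?T (\<lambda>e. ?\<phi> (y e) (z e))) \<partial>?\<nu>)"
      proof (cases "y \<in> A")
        case True
        with y obtain es J where es: "is_path H v es w" "J \<subseteq> set es" "card J \<le> K"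
          "path_time (\<lambda>e. if e \<in> J then b else y e / (1 - \<eta>)) es < s" by blast
        have J: "finite J" "J \<subseteq> ?E"
          using es(1,2) is_path_edges[OF es(1)] by (auto intro: finite_subset)
        \<comment> \<open>The clocks of \<open>z\<close> on \<open>J\<close> are independent, and each is at most \<open>b\<close> with probability \<open>p\<close>.\<close>
        have "p ^ K \<le> p ^ card J"
          using p es(3) by (intro power_decreasing) auto
        then have "ennreal (p ^ K) * indicator A y \<le> (\<Prod>j\<in>J. ennreal p)"
          using True p by (simp add: ennreal_power ennreal_leI)
        also have "\<dots> = (\<Prod>j\<in>J. \<integral>\<^sup>+x. indicator {..b} x \<partial>exp_law \<eta>)"
          using measure_exp_law_atMost[OF \<eta>(1) b] p
          by (simp add: B.emeasure_eq_measure p_def)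
        also have "\<dots> = (\<integral>\<^sup>+z. (\<Prod>j\<in>J. indicator {..b} (z j)) \<partial>?\<nu>)"
          using J by (intro B.nn_integral_iid_field_prod[symmetric]) auto
        also have "\<dots> \<le> (\<integral>\<^sup>+z. indicator {..<ereal s} (?T (\<lambda>e. ?\<phi> (y e) (z e))) \<partial>?\<nu>)"
        proof (rule nn_integral_mono)
          fix z
          show "(\<Prod>j\<in>J. indicator {..b} (z j))
            \<le> (indicator {..<ereal s} (?T (\<lambda>e. ?\<phi> (y e) (z e))) :: ennreal)"
          proof (cases "\<forall>j\<in>J. z j \<le> b")
            case True
            then have "path_time (\<lambda>e. ?\<phi> (y e) (z e)) es
                \<le> path_time (\<lambda>e. if e \<in> J then b else y e / (1 - \<eta>)) es"
              by (intro path_time_mono) auto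
            with es have "?T (\<lambda>e. ?\<phi> (y e) (z e)) < ereal s"
              unfolding field_time_less_iff by fastforce
            moreover have "(\<Prod>j\<in>J. indicator {..b} (z j)) = (1 :: ennreal)"
              using True by (intro prod.neutral) auto
            ultimately show ?thesis by simp
          next
            case False
            then have "(\<Prod>j\<in>J. indicator {..b} (z j)) = (0 :: ennreal)"
              using J(1) by (auto intro!: prod_zero simp: indicator_def)
            then show ?thesis by (simp only: zero_le)
          qed
        qed
        finally show ?thesis .
      qed simp
    qed
  qed
  also have "(\<integral>\<^sup>+y. ennreal (p ^ K) * indicator A y \<partial>?\<mu>) = ennreal (p ^ K) * emeasure ?\<mu> A"
    by (simp add: nn_integral_cmult_indicator)
  finally have "ennreal (p ^ K * measure ?\<mu> A) \<le> ennreal (measure ?\<mu> {y \<in> space ?\<mu>. ?T y < ereal s})"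
    using p by (simp add: A.pps.emeasure_eq_measure ennreal_mult)
  then show ?thesis
    by (simp add: p_def mult.commute)
qed

section \<open>Realising a distribution by exponential variables\<close>

text \<open>The quantile transform of \<open>F\<close>, written for an exponential instead of a uniform variable.  The
  value \<open>0\<close> on the null set \<open>x \<le> 0\<close> keeps the function monotone and nonnegative for laws on
  \<open>[0, \<infinity>)\<close>.\<close>

definition exp_quantile :: "real measure \<Rightarrow> real \<Rightarrow> real" where
  "exp_quantile F x = (if 0 < x then Inf {z. 1 - exp (- x) \<le> cdf F z} else 0)"

locale nonneg_distribution = cdf_distribution F for F :: "real measure" +
  assumes measure_neg: "measure F {..<0} = 0"
begin

lemma cdf_neg: "z < 0 \<Longrightarrow> cdf F z = 0"
  using finite_measure_mono[of "{..z}" "{..<0}"] measure_neg measure_nonneg[of F "{..z}"]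
  by (force simp: cdf_def)

lemma exp_quantile_le_iff: "0 < x \<Longrightarrow> exp_quantile F x \<le> z \<longleftrightarrow> 1 - exp (- x) \<le> cdf F z"
  unfolding exp_quantile_def using pseudoinverse[of "1 - exp (- x)" z] by simp

lemma exp_quantile_nonneg: "0 \<le> exp_quantile F x"
proof (cases "0 < x")
  case True
  then show ?thesis
    using exp_quantile_le_iff[OF True, of "exp_quantile F x"] cdf_neg[of "exp_quantile F x"]
    by (cases "exp_quantile F x < 0") auto
qed (simp add: exp_quantile_def)

lemma mono_exp_quantile: "mono (exp_quantile F)"
proof (rule monoI)
  fix x y :: real assume xy: "x \<le> y"
  show "exp_quantile F x \<le> exp_quantile F y"
  proof (cases "0 < x")
    case True
    have "1 - exp (- x) \<le> 1 - exp (- y)" using xy by simp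
    also have "\<dots> \<le> cdf F (exp_quantile F y)"
      using True xy exp_quantile_le_iff[of y "exp_quantile F y"] by simp
    finally show ?thesis using exp_quantile_le_iff[OF True] by simp
  next
    case False
    then show ?thesis using exp_quantile_nonneg[of y] by (simp add: exp_quantile_def)
  qed
qed

lemma measurable_exp_quantile [measurable]: "exp_quantile F \<in> borel_measurable borel"
  by (rule borel_measurable_mono) (rule mono_exp_quantile)

lemma borel_prob: "borel_prob F"
  using prob_space_axioms events_eq_borel
  by (simp add: borel_prob_def borel_prob_axioms_def)

lemma distr_exp_quantile: "distr Exp1 borel (exp_quantile F) = F"
proof (rule cdf_unique)
  interpret E: borel_prob Exp1 by (rule borel_prob_Exp1)
  have q [measurable]: "exp_quantile F \<in> borel_measurable Exp1" by simp
  show "real_distribution (distr Exp1 borel (exp_quantile F))"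
    by (rule E.real_distribution_distr) (rule q)
  show "real_distribution F" by (rule real_distribution_axioms)
  show "cdf (distr Exp1 borel (exp_quantile F)) = cdf F"
  proof
    fix z
    have cdf: "cdf (distr Exp1 borel (exp_quantile F)) z = measure Exp1 {x. exp_quantile F x \<le> z}"
      by (simp add: cdf_def measure_distr vimage_def)
    show "cdf (distr Exp1 borel (exp_quantile F)) z = cdf F z"
    proof (cases "z < 0")
      case True
      then have "\<not> exp_quantile F x \<le> z" for x using exp_quantile_nonneg[of x] by linarith
      then show ?thesis using cdf cdf_neg[OF True] by simp
    next
      case False
      have le: "exp_quantile F x \<le> z \<longleftrightarrow> x \<le> 0 \<or> 1 - exp (- x) \<le> cdf F z" for x
        using False exp_quantile_le_iff[of x z] by (cases "0 < x") (auto simp: exp_quantile_def)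
      show ?thesis
      proof (cases "cdf F z < 1")
        case True
        define a where "a = - ln (1 - cdf F z)"
        have a: "0 \<le> a" "exp (- a) = 1 - cdf F z"
          using True cdf_nonneg[of z] by (auto simp: a_def)
        have "{x. exp_quantile F x \<le> z} = {..a}"
        proof (rule set_eqI)
          fix x
          have "1 - exp (- x) \<le> cdf F z \<longleftrightarrow> exp (- a) \<le> exp (- x)" using a(2) by auto
          then have "1 - exp (- x) \<le> cdf F z \<longleftrightarrow> x \<le> a" by simp
          then show "x \<in> {x. exp_quantile F x \<le> z} \<longleftrightarrow> x \<in> {..a}" using a(1) le[of x] by auto
        qed
        then show ?thesis
          using a measure_Exp1(1)[of a] by (simp add: cdf)
      next
        case False
        then have one: "cdf F z = 1" using cdf_bounded_prob[of z] by simp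
        then have "{x. exp_quantile F x \<le> z} = UNIV" using le by auto
        then show ?thesis using one cdf E.prob_space by simp
      qed
    qed
  qed
qed

lemma distr_exp_quantile_of:
  assumes [measurable]: "case_prod \<phi> \<in> borel_measurable (borel \<Otimes>\<^sub>M borel)"
    and P: "sets P = sets (borel \<Otimes>\<^sub>M borel)" and law: "distr P borel (case_prod \<phi>) = Exp1"
  shows "distr P borel (\<lambda>(x, z). exp_quantile F (\<phi> x z)) = F"
proof -
  have [measurable_cong]: "sets P = sets (borel \<Otimes>\<^sub>M borel)" by (rule P)
  have "F = distr (distr P borel (case_prod \<phi>)) borel (exp_quantile F)"
    unfolding law by (rule distr_exp_quantile[symmetric])
  also have "\<dots> = distr P borel (exp_quantile F \<circ> case_prod \<phi>)"
    by (rule distr_distr) measurable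
  also have "exp_quantile F \<circ> case_prod \<phi> = (\<lambda>(x, z). exp_quantile F (\<phi> x z))"
    by auto
  finally show ?thesis ..
qed

end

lemma class_C_nonneg_distribution: "F \<in> class_C \<rho> \<Longrightarrow> nonneg_distribution F"
  by (simp add: class_C_def nonneg_distribution_def cdf_distribution_def nonneg_distribution_axioms_def)

text \<open>Both inequalities are statements about the distribution function near \<open>0\<close>.  The first says
  \<open>F(z) < 1 - exp(-(1 + \<eta>) \<rho> z)\<close>, which holds because the slopes at \<open>0\<close> are \<open>\<rho> < (1 + \<eta>) \<rho>\<close>; the
  second follows from \<open>1 - exp(-x) \<le> x \<le> F((1 + \<eta>) x / \<rho>)\<close>.\<close>

lemma exp_quantile_near_zero:
  assumes F: "F \<in> class_C \<rho>" and \<rho>: "0 < \<rho>" and \<eta>: "0 < \<eta>"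
  shows "\<exists>\<delta>>0. \<forall>x>0.
    (exp_quantile F x \<le> \<delta> \<longrightarrow> x \<le> (1 + \<eta>) * \<rho> * exp_quantile F x) \<and>
    (x \<le> \<delta> \<longrightarrow> exp_quantile F x \<le> (1 + \<eta>) / \<rho> * x)"
proof -
  interpret nonneg_distribution F using F by (rule class_C_nonneg_distribution)
  have lim: "((\<lambda>z. cdf F z / z) \<longlongrightarrow> \<rho>) (at_right 0)" using F by (simp add: class_C_def)
  define k where "k = (1 + \<eta>) * \<rho>"
  have k: "\<rho> < k" using \<rho> \<eta> by (simp add: k_def)
  have "((\<lambda>z. 1 - exp (- k * z)) has_field_derivative k) (at 0)"
    by (auto intro!: derivative_eq_intros)
  then have "((\<lambda>z. (1 - exp (- k * z)) / z) \<longlongrightarrow> k) (at 0)"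
    by (simp add: has_field_derivative_iff)
  then have lim': "((\<lambda>z. (1 - exp (- k * z)) / z) \<longlongrightarrow> k) (at_right 0)"
    by (rule filterlim_mono[OF _ order_refl]) (simp add: at_le)
  obtain m where m: "\<rho> < m" "m < k" using dense[OF k] by blast
  have "\<forall>\<^sub>F z in at_right 0. cdf F z / z < m" by (rule order_tendstoD(2)[OF lim m(1)])
  moreover have "\<forall>\<^sub>F z in at_right 0. m < (1 - exp (- k * z)) / z"
    by (rule order_tendstoD(1)[OF lim' m(2)])
  moreover have "\<forall>\<^sub>F z in at_right 0. \<rho> / (1 + \<eta>) < cdf F z / z"
    by (rule order_tendstoD(1)[OF lim]) (use \<rho> \<eta> in \<open>simp add: pos_divide_less_eq algebra_simps\<close>)
  ultimately have "\<forall>\<^sub>F z in at_right 0. cdf F z / z < (1 - exp (- k * z)) / z \<and> \<rho> / (1 + \<eta>) < cdf F z / z"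
    by eventually_elim auto
  then obtain d where d: "0 < d" and
    bnd: "\<And>z. 0 < z \<Longrightarrow> z < d \<Longrightarrow> cdf F z / z < (1 - exp (- k * z)) / z \<and> \<rho> / (1 + \<eta>) < cdf F z / z"
    by (auto simp: eventually_at_right_field)
  define c where "c = (1 + \<eta>) / \<rho>"
  have c: "0 < c" using \<rho> \<eta> by (simp add: c_def)
  have up: "cdf F z < 1 - exp (- k * z)" if "0 < z" "z < d" for z
    using bnd[OF that] that(1) by (simp add: divide_less_cancel)
  have low: "z / c \<le> cdf F z" if "0 < z" "z < d" for z
    using bnd[OF that] that(1) \<rho> \<eta> by (simp add: c_def field_simps)
  \<comment> \<open>There is no atom at \<open>0\<close>: \<open>F(0) \<le> F(z) < 1 - exp(-k z)\<close>, which tends to \<open>0\<close>.\<close>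
  have cdf0: "cdf F 0 \<le> 0"
  proof (rule tendsto_lowerbound)
    have "continuous (at 0) (\<lambda>z. 1 - exp (- k * z))" by simp
    then show "((\<lambda>z. 1 - exp (- k * z)) \<longlongrightarrow> 0) (at_right 0)"
      by (auto simp: continuous_at intro: filterlim_mono[OF _ order_refl at_le])
    have "\<forall>\<^sub>F z in at_right 0. z \<in> {0<..<d}" using d eventually_at_right_real by blast
    then show "\<forall>\<^sub>F z in at_right 0. cdf F 0 \<le> 1 - exp (- k * z)"
    proof eventually_elim
      case (elim z)
      then show ?case using up[of z] cdf_nondecreasing[of 0 z] by simp
    qed
  qed simp
  show ?thesis
  proof (intro exI[of _ "min (d / 2) (d / (2 * c))"] conjI allI impI)
    show "0 < min (d / 2) (d / (2 * c))" using d c by simp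
  next
    fix x assume x: "0 < x" "exp_quantile F x \<le> min (d / 2) (d / (2 * c))"
    define z where "z = exp_quantile F x"
    have Fz: "1 - exp (- x) \<le> cdf F z" using exp_quantile_le_iff[OF x(1), of z] by (simp add: z_def)
    have "0 < 1 - exp (- x)" using x(1) by simp
    with Fz have "0 < cdf F z" by linarith
    then have "z \<noteq> 0" using cdf0 by auto
    then have z: "0 < z" "z < d" using exp_quantile_nonneg[of x] x(2) d by (auto simp: z_def)
    have "exp (- (k * z)) < exp (- x)" using Fz up[OF z] unfolding mult_minus_left by linarith
    then show "x \<le> (1 + \<eta>) * \<rho> * exp_quantile F x" by (simp add: k_def z_def)
  next
    fix x assume x: "0 < x" "x \<le> min (d / 2) (d / (2 * c))"
    have "c * x \<le> d / 2" using x c by (simp add: field_simps)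
    then have "c * x / c \<le> cdf F (c * x)" using x c d by (intro low) auto
    moreover have "1 - exp (- x) \<le> x" using exp_ge_add_one_self[of "- x"] by simp
    ultimately have "1 - exp (- x) \<le> cdf F (c * x)" using c by simp
    then show "exp_quantile F x \<le> (1 + \<eta>) / \<rho> * x"
      using exp_quantile_le_iff[OF x(1)] by (simp add: c_def)
  qed
qed

lemma (in bounded_degree_graph) prob_field_time_less_quantile:
  assumes F: "nonneg_distribution F"
  shows "prob_field_time_less F H v w s = measure (iid_field (edges H) Exp1)
    {y \<in> space (iid_field (edges H) Exp1). field_time H v w (\<lambda>e. exp_quantile F (y e)) < ereal s}"
proof -
  interpret nonneg_distribution F by fact
  interpret E: borel_prob Exp1 by (rule borel_prob_Exp1)
  interpret F: borel_prob F by (rule borel_prob)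
  let ?\<mu> = "iid_field (edges H) Exp1"
  have "distr (Exp1 \<Otimes>\<^sub>M Exp1) borel (\<lambda>(x, z). x) = distr (Exp1 \<Otimes>\<^sub>M Exp1) Exp1 fst"
    by (rule distr_cong) auto
  then have "distr (Exp1 \<Otimes>\<^sub>M Exp1) borel (\<lambda>(x, z). x) = Exp1"
    using E.distr_pair_fst[of Exp1] by simp
  then have law: "distr (Exp1 \<Otimes>\<^sub>M Exp1) borel (\<lambda>(x, z). exp_quantile F x) = F"
    by (intro distr_exp_quantile_of) (auto cong: sets_pair_measure_cong)
  have [measurable]: "(\<lambda>y. field_time H v w (\<lambda>e. exp_quantile F (y e))) \<in> borel_measurable ?\<mu>"
    by (rule measurable_field_time_map[OF borel_prob_Exp1]) measurable
  have [measurable]: "field_time H v w \<in> borel_measurable (iid_field (edges H) F)"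
    by (rule measurable_field_time[OF borel_prob])
  have "emeasure (iid_field (edges H) F) {y \<in> space (iid_field (edges H) F). field_time H v w y < ereal s}
     = (\<integral>\<^sup>+y. indicator {y \<in> space (iid_field (edges H) F). field_time H v w y < ereal s} y \<partial>iid_field (edges H) F)"
    by (subst nn_integral_indicator) auto
  also have "\<dots> = (\<integral>\<^sup>+y. indicator {..<ereal s} (field_time H v w y) \<partial>iid_field (edges H) F)"
    by (intro nn_integral_cong) (auto simp: indicator_def)
  also have "\<dots> = (\<integral>\<^sup>+y. \<integral>\<^sup>+z. indicator {..<ereal s} (field_time H v w (\<lambda>e. exp_quantile F (y e))) \<partial>?\<mu> \<partial>?\<mu>)"
    by (rule nn_integral_coupled_field_time[OF borel_prob_Exp1 borel_prob_Exp1 borel_prob _ law]) auto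
  also have "\<dots> = (\<integral>\<^sup>+y. indicator {..<ereal s} (field_time H v w (\<lambda>e. exp_quantile F (y e))) \<partial>?\<mu>)"
    by (simp add: E.pps.emeasure_space_1)
  also have "\<dots> = (\<integral>\<^sup>+y. indicator {y \<in> space ?\<mu>. field_time H v w (\<lambda>e. exp_quantile F (y e)) < ereal s} y \<partial>?\<mu>)"
    by (intro nn_integral_cong) (auto simp: indicator_def)
  also have "\<dots> = emeasure ?\<mu> {y \<in> space ?\<mu>. field_time H v w (\<lambda>e. exp_quantile F (y e)) < ereal s}"
    by (subst nn_integral_indicator) auto
  finally show ?thesis
    by (simp add: prob_field_time_less_def measure_def)
qed

section \<open>The lower tail\<close>

lemma exists_small_parameter:
  fixes f :: "real \<Rightarrow> real"
  assumes "(f \<longlongrightarrow> l) (at_right 0)" "l < u"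
  shows "\<exists>\<eta>. 0 < \<eta> \<and> \<eta> < 1 \<and> f \<eta> < u"
proof -
  have "\<forall>\<^sub>F \<eta> in at_right 0. f \<eta> < u"
    using assms by (rule order_tendstoD(2))
  moreover have "\<forall>\<^sub>F \<eta> in at_right 0. \<eta> \<in> {0<..<1::real}"
    by (rule eventually_at_right_real) simp
  ultimately have "\<forall>\<^sub>F \<eta> in at_right 0. 0 < \<eta> \<and> \<eta> < 1 \<and> f \<eta> < u"
    by eventually_elim simp
  then show ?thesis
    by (rule eventually_happens'[OF trivial_limit_at_right_real])
qed

text \<open>In a path of \<open>q(y)\<close>-length below \<open>s'\<close> a light edge satisfies \<open>y \<le> (1 + \<eta>) \<rho> q(y)\<close>, while a
  heavy edge satisfies \<open>\<rho> \<delta> \<le> \<rho> q(y)\<close>.  Sprinkling the at most \<open>s' / \<delta>\<close> heavy edges down to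
  \<open>b = \<rho> \<delta>\<close> thus produces a path of length at most \<open>(1 + \<eta>) / (1 - \<eta>) \<rho> s'\<close>.\<close>

lemma lower_tail:
  assumes F: "F \<in> class_C \<rho>" and \<rho>: "0 < \<rho>" and s: "\<rho> * s' < s"
  shows "\<exists>C. \<forall>(H :: ('v, 'e) mixed_graph) v w. bounded_degree_graph H \<longrightarrow>
    prob_field_time_less F H v w s' \<le> C * prob_field_time_less Exp1 H v w s"
proof (cases "0 < s'")
  case False
  have "prob_field_time_less F H v w s' \<le> 0 * prob_field_time_less Exp1 H v w s"
    if "bounded_degree_graph H" for H :: "('v, 'e) mixed_graph" and v w
  proof -
    interpret bounded_degree_graph H by fact
    interpret nonneg_distribution F using F by (rule class_C_nonneg_distribution)
    have "\<not> field_time H v w (\<lambda>e. exp_quantile F (y e)) < ereal s'" for y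
    proof -
      have "0 \<le> field_time H v w (\<lambda>e. exp_quantile F (y e))"
        by (rule field_time_nonneg) (rule exp_quantile_nonneg)
      moreover have "ereal s' \<le> 0" using False by simp
      ultimately show ?thesis by (meson linorder_not_less order_trans)
    qed
    then show ?thesis
      by (subst prob_field_time_less_quantile[OF nonneg_distribution_axioms]) simp
  qed
  then show ?thesis by blast
next
  case s': True
  interpret nonneg_distribution F using F by (rule class_C_nonneg_distribution)
  have lim: "((\<lambda>\<eta>. (1 + \<eta>) / (1 - \<eta>) * \<rho> * s') \<longlongrightarrow> (1 + 0) / (1 - 0) * \<rho> * s') (at_right 0)"
    by (intro tendsto_intros) auto
  have "(1 + 0) / (1 - 0) * \<rho> * s' < s" using s by simp
  from exists_small_parameter[OF lim this] obtain \<eta> where \<eta>: "0 < \<eta>" "\<eta> < 1"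
    and \<eta>s: "(1 + \<eta>) / (1 - \<eta>) * \<rho> * s' < s"
    by blast
  define c where "c = (1 + \<eta>) / (1 - \<eta>) * \<rho>"
  have "1 \<le> (1 + \<eta>) / (1 - \<eta>)" using \<eta> by (simp add: pos_le_divide_eq)
  then have "1 * \<rho> \<le> (1 + \<eta>) / (1 - \<eta>) * \<rho>" using \<rho> by (intro mult_right_mono) auto
  then have c: "\<rho> \<le> c" "0 < c" using \<rho> by (simp_all only: c_def)
  obtain \<delta> where \<delta>: "0 < \<delta>"
    and q: "\<And>x. 0 < x \<Longrightarrow> exp_quantile F x \<le> \<delta> \<Longrightarrow> x \<le> (1 + \<eta>) * \<rho> * exp_quantile F x"
    using exp_quantile_near_zero[OF F \<rho> \<eta>(1)] by blast
  define K where "K = nat \<lceil>s' / \<delta>\<rceil>"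
  define p where "p = 1 - exp (- (\<rho> * \<delta> * \<eta>))"
  have p: "0 < p" using \<rho> \<delta> \<eta> by (simp add: p_def)
  have "prob_field_time_less F H v w s' \<le> inverse (p ^ K) * prob_field_time_less Exp1 H v w s"
    if "bounded_degree_graph H" for H :: "('v, 'e) mixed_graph" and v w
  proof -
    interpret bounded_degree_graph H by fact
    let ?\<mu> = "iid_field (edges H) Exp1"
    let ?A = "{y \<in> space ?\<mu>. field_time H v w (\<lambda>e. exp_quantile F (y e)) < ereal s'}"
    have [measurable]: "(\<lambda>y. field_time H v w (\<lambda>e. exp_quantile F (y e))) \<in> borel_measurable ?\<mu>"
      by (rule measurable_field_time_map[OF borel_prob_Exp1]) measurable
    have "measure ?\<mu> ?A * (1 - exp (- (\<rho> * \<delta> * \<eta>))) ^ K \<le> measure ?\<mu> {y \<in> space ?\<mu>. field_time H v w y < ereal s}"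
    proof (rule sprinkling[OF \<eta>])
      show "0 \<le> \<rho> * \<delta>" using \<rho> \<delta> by simp
      show "?A \<in> sets ?\<mu>" by measurable
      show "AE y in ?\<mu>. y \<in> ?A \<longrightarrow> (\<exists>es J. is_path H v es w \<and> J \<subseteq> set es \<and> card J \<le> K \<and>
         path_time (\<lambda>e. if e \<in> J then \<rho> * \<delta> else y e / (1 - \<eta>)) es < s)"
        using AE_iid_Exp1_pos[OF countable_edges]
      proof eventually_elim
        case (elim y)
        show ?case
        proof
          assume "y \<in> ?A"
          then obtain es where es: "is_path H v es w" "path_time (\<lambda>e. exp_quantile F (y e)) es < s'"
            by (auto simp: field_time_less_iff)
          have pos: "0 < y e" if "e \<in> set es" for e
            using elim is_path_edges[OF es(1)] that by auto
          define J where "J = {e \<in> set es. \<delta> < exp_quantile F (y e)}"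
          have "\<delta> * real (card J) \<le> path_time (\<lambda>e. exp_quantile F (y e)) es"
            by (rule card_heavy_edges_le) (auto simp: J_def exp_quantile_nonneg)
          then have "real (card J) \<le> s' / \<delta>"
            using es(2) \<delta> by (simp add: field_simps)
          then have card: "card J \<le> K"
            unfolding K_def by linarith
          have "path_time (\<lambda>e. if e \<in> J then \<rho> * \<delta> else y e / (1 - \<eta>)) es
              \<le> path_time (\<lambda>e. c * exp_quantile F (y e)) es"
          proof (rule path_time_mono)
            fix e assume e: "e \<in> set es"
            show "(if e \<in> J then \<rho> * \<delta> else y e / (1 - \<eta>)) \<le> c * exp_quantile F (y e)"
            proof (cases "e \<in> J")
              case True
              then have "\<rho> * \<delta> \<le> c * exp_quantile F (y e)"
                using \<rho> \<delta> c by (intro mult_mono) (auto simp: J_def)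
              then show ?thesis using True by simp
            next
              case False
              then have "y e \<le> (1 + \<eta>) * \<rho> * exp_quantile F (y e)"
                using q[OF pos[OF e]] e by (simp add: J_def)
              then have "y e / (1 - \<eta>) \<le> (1 + \<eta>) * \<rho> * exp_quantile F (y e) / (1 - \<eta>)"
                using \<eta> by (intro divide_right_mono) auto
              then show ?thesis using False by (simp add: c_def)
            qed
          qed
          also have "\<dots> = c * path_time (\<lambda>e. exp_quantile F (y e)) es"
            by (rule path_time_cmult)
          also have "\<dots> \<le> c * s'" using es(2) c by (intro mult_left_mono) auto
          also have "\<dots> < s" using \<eta>s by (simp add: c_def)
          finally show "\<exists>es J. is_path H v es w \<and> J \<subseteq> set es \<and> card J \<le> K \<and>
              path_time (\<lambda>e. if e \<in> J then \<rho> * \<delta> else y e / (1 - \<eta>)) es < s"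
            using es(1) card by (intro exI[of _ es] exI[of _ J]) (auto simp: J_def)
        qed
      qed
    qed
    then have "prob_field_time_less F H v w s' * p ^ K \<le> prob_field_time_less Exp1 H v w s"
      unfolding prob_field_time_less_quantile[OF nonneg_distribution_axioms] prob_field_time_less_def[of Exp1] p_def .
    moreover have "0 < p ^ K" using p by simp
    ultimately show ?thesis by (simp add: inverse_eq_divide pos_le_divide_eq)
  qed
  then show ?thesis by (intro exI[of _ "inverse (p ^ K)"] allI impI)
qed

section \<open>Near-optimal paths without heavy edges\<close>

text \<open>For positive weights, this is the event that some path from \<open>v\<close> to \<open>w\<close> of length less than \<open>t\<close>
  uses only edges of weight at most \<open>\<delta>\<close>.  Giving every heavier edge the weight \<open>t\<close> excludes it from such paths and presents
  the event as one about a passage time, which makes it measurable.\<close>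

definition light_event ::
    "real \<Rightarrow> ('v, 'e) mixed_graph \<Rightarrow> 'v \<Rightarrow> 'v \<Rightarrow> real \<Rightarrow> ('e \<Rightarrow> real) set" where
  "light_event \<delta> H v w t = {y \<in> space (iid_field (edges H) Exp1).
     field_time H v w (\<lambda>e. if y e \<le> \<delta> then y e else t) < ereal t}"

lemma (in bounded_degree_graph) sets_light_event:
  "light_event \<delta> H v w t \<in> sets (iid_field (edges H) Exp1)"
proof -
  have [measurable]: "(\<lambda>y. field_time H v w (\<lambda>e. if y e \<le> \<delta> then y e else t))
      \<in> borel_measurable (iid_field (edges H) Exp1)"
    by (rule measurable_field_time_map[OF borel_prob_Exp1]) measurable
  show ?thesis unfolding light_event_def by measurable
qed

lemma light_eventE:
  assumes y: "y \<in> light_event \<delta> H v w t" and pos: "\<forall>e\<in>edges H. 0 < y e" and t: "0 \<le> t"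
  obtains es where "is_path H v es w" "path_time y es < t" "\<And>e. e \<in> set es \<Longrightarrow> y e \<le> \<delta>"
proof -
  let ?z = "\<lambda>e. if y e \<le> \<delta> then y e else t"
  obtain es where es: "is_path H v es w" "path_time ?z es < t"
    using y by (auto simp: light_event_def field_time_less_iff)
  have light: "y e \<le> \<delta>" if "e \<in> set es" for e
  proof (rule ccontr)
    assume heavy: "\<not> y e \<le> \<delta>"
    have "0 \<le> ?z e'" if "e' \<in> set es" for e'
    proof -
      have "0 < y e'" using pos is_path_edges[OF es(1)] that by blast
      then show ?thesis using t by simp
    qed
    then have "?z e \<le> path_time ?z es"
      by (rule member_le_path_time) (use that in auto)
    with heavy es(2) show False by simp
  qed
  have "path_time y es = path_time ?z es"
    by (rule path_time_cong) (use light in auto)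
  with es light show ?thesis by (intro that) auto
qed

text \<open>Suppose that \<open>y\<close> has a path of length less than \<open>t'\<close> but no light one.  That path has between one
  and \<open>t' / \<delta>\<close> heavy edges.  Sprinkling them down to \<open>\<delta> / 2\<close> saves at least \<open>\<delta> / 2\<close> for each, so
  the length drops below \<open>t' / (1 - \<eta>) - \<delta> / 2\<close>, and this is below \<open>t - \<delta> / 4\<close> for \<open>t'\<close> close to
  \<open>t\<close> and small \<open>\<eta>\<close>.\<close>

lemma light_paths:
  assumes \<delta>: "0 < \<delta>" and \<kappa>: "0 < \<kappa>" and t: "0 \<le> t"
  shows "\<exists>t' C. t < t' \<and> t' < t + \<kappa> \<and> (\<forall>(H :: ('v, 'e) mixed_graph) v w. bounded_degree_graph H \<longrightarrow>
    prob_field_time_less Exp1 H v w t' \<le> measure (iid_field (edges H) Exp1) (light_event \<delta> H v w t')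
      + C * prob_field_time_less Exp1 H v w (t - \<delta> / 4))"
proof -
  \<comment> \<open>Any \<open>t'\<close> with \<open>t < t' < t + \<delta> / 4\<close> leaves room for the factor \<open>1 / (1 - \<eta>)\<close>.\<close>
  define t' where "t' = t + min (\<kappa> / 2) (\<delta> / 8)"
  have t': "t < t'" "t' < t + \<kappa>" "t' < t + \<delta> / 4" "0 < t'" using \<delta> \<kappa> t by (auto simp: t'_def)
  have lim: "((\<lambda>\<eta>. t' / (1 - \<eta>)) \<longlongrightarrow> t' / (1 - 0)) (at_right 0)"
    by (intro tendsto_intros) auto
  have "t' / (1 - 0) < t + \<delta> / 4" using t' by simp
  from exists_small_parameter[OF lim this] obtain \<eta> where \<eta>: "0 < \<eta>" "\<eta> < 1" and \<eta>t: "t' / (1 - \<eta>) < t + \<delta> / 4"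
    by blast
  define K where "K = nat \<lceil>t' / \<delta>\<rceil>"
  define p where "p = 1 - exp (- (\<delta> / 2 * \<eta>))"
  have p: "0 < p" using \<delta> \<eta> by (simp add: p_def)
  have "prob_field_time_less Exp1 H v w t' \<le> measure (iid_field (edges H) Exp1) (light_event \<delta> H v w t')
      + inverse (p ^ K) * prob_field_time_less Exp1 H v w (t - \<delta> / 4)"
    if "bounded_degree_graph H" for H :: "('v, 'e) mixed_graph" and v w
  proof -
    interpret bounded_degree_graph H by fact
    interpret E: borel_prob Exp1 by (rule borel_prob_Exp1)
    let ?\<mu> = "iid_field (edges H) Exp1"
    let ?B = "light_event \<delta> H v w t'"
    let ?A = "{y \<in> space ?\<mu>. field_time H v w y < ereal t'}"
    note [measurable] = measurable_field_time[OF borel_prob_Exp1] sets_light_event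
    have "measure ?\<mu> (?A - ?B) * (1 - exp (- (\<delta> / 2 * \<eta>))) ^ K
        \<le> measure ?\<mu> {y \<in> space ?\<mu>. field_time H v w y < ereal (t - \<delta> / 4)}"
    proof (rule sprinkling[OF \<eta>])
      show "0 \<le> \<delta> / 2" using \<delta> by simp
      show "?A - ?B \<in> sets ?\<mu>" by measurable
      show "AE y in ?\<mu>. y \<in> ?A - ?B \<longrightarrow> (\<exists>es J. is_path H v es w \<and> J \<subseteq> set es \<and> card J \<le> K \<and>
         path_time (\<lambda>e. if e \<in> J then \<delta> / 2 else y e / (1 - \<eta>)) es < t - \<delta> / 4)"
        using AE_iid_Exp1_pos[OF countable_edges]
      proof eventually_elim
        case (elim y)
        show ?case
        proof
          assume y: "y \<in> ?A - ?B"
          then obtain es where es: "is_path H v es w" "path_time y es < t'"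
            by (auto simp: field_time_less_iff)
          have pos: "0 < y e" if "e \<in> set es" for e
            using elim is_path_edges[OF es(1)] that by auto
          define J where "J = {e \<in> set es. \<delta> < y e}"
          have "J \<noteq> {}"
          proof
            assume "J = {}"
            then have "path_time (\<lambda>e. if y e \<le> \<delta> then y e else t') es = path_time y es"
              by (intro path_time_cong) (auto simp: J_def)
            then have "y \<in> ?B"
              using y es by (auto simp: light_event_def field_time_less_iff)
            with y show False by simp
          qed
          then obtain e\<^sub>0 where e\<^sub>0: "e\<^sub>0 \<in> J" by blast
          have "\<delta> * real (card J) \<le> path_time y es"
            by (rule card_heavy_edges_le) (auto simp: J_def intro: less_imp_le pos)
          then have "real (card J) \<le> t' / \<delta>"
            using es(2) \<delta> by (simp add: field_simps)
          then have card: "card J \<le> K"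
            unfolding K_def by linarith
          \<comment> \<open>The amount \<open>?d e\<close> is saved on the edge \<open>e\<close>; one heavy edge \<open>e\<^sub>0\<close> already saves \<open>\<delta> / 2\<close>.\<close>
          let ?d = "\<lambda>e. if e \<in> J then \<delta> / 2 else 0"
          have "path_time (\<lambda>e. if e \<in> J then \<delta> / 2 else y e / (1 - \<eta>)) es + path_time ?d es
              = path_time (\<lambda>e. (if e \<in> J then \<delta> / 2 else y e / (1 - \<eta>)) + ?d e) es"
            by (rule path_time_add[symmetric])
          also have "\<dots> \<le> path_time (\<lambda>e. 1 / (1 - \<eta>) * y e) es"
          proof (rule path_time_mono)
            fix e assume e: "e \<in> set es"
            have "y e \<le> y e / (1 - \<eta>)" using \<eta> pos[OF e] by (simp add: field_simps)
            then show "(if e \<in> J then \<delta> / 2 else y e / (1 - \<eta>)) + ?d e \<le> 1 / (1 - \<eta>) * y e"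
              by (auto simp: J_def)
          qed
          also have "\<dots> = 1 / (1 - \<eta>) * path_time y es" by (rule path_time_cmult)
          also have "\<dots> \<le> t' / (1 - \<eta>)" using es(2) \<eta> by (simp add: divide_right_mono)
          also have "\<dots> < t + \<delta> / 4" by (rule \<eta>t)
          finally have "path_time (\<lambda>e. if e \<in> J then \<delta> / 2 else y e / (1 - \<eta>)) es + path_time ?d es
              < t + \<delta> / 4" .
          moreover have "?d e\<^sub>0 \<le> path_time ?d es"
            by (rule member_le_path_time) (use e\<^sub>0 \<delta> in \<open>auto simp: J_def\<close>)
          ultimately have "path_time (\<lambda>e. if e \<in> J then \<delta> / 2 else y e / (1 - \<eta>)) es < t - \<delta> / 4"
            using e\<^sub>0 by simp
          then show "\<exists>es J. is_path H v es w \<and> J \<subseteq> set es \<and> card J \<le> K \<and>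
              path_time (\<lambda>e. if e \<in> J then \<delta> / 2 else y e / (1 - \<eta>)) es < t - \<delta> / 4"
            using es(1) card by (intro exI[of _ es] exI[of _ J]) (auto simp: J_def)
        qed
      qed
    qed
    then have "measure ?\<mu> (?A - ?B) * p ^ K \<le> prob_field_time_less Exp1 H v w (t - \<delta> / 4)"
      unfolding prob_field_time_less_def p_def .
    moreover have "0 < p ^ K" using p by simp
    ultimately have "measure ?\<mu> (?A - ?B) \<le> inverse (p ^ K) * prob_field_time_less Exp1 H v w (t - \<delta> / 4)"
      by (simp add: inverse_eq_divide pos_le_divide_eq)
    moreover have "measure ?\<mu> ?A \<le> measure ?\<mu> (?B \<union> (?A - ?B))"
      by (rule E.pps.finite_measure_mono) auto
    moreover have "measure ?\<mu> (?B \<union> (?A - ?B)) \<le> measure ?\<mu> ?B + measure ?\<mu> (?A - ?B)"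
      by (rule measure_Un_le) measurable
    ultimately show ?thesis by (simp add: prob_field_time_less_def)
  qed
  with t' show ?thesis
    by (intro exI[of _ t'] exI[of _ "inverse (p ^ K)"] conjI allI impI)
qed

section \<open>The upper tail\<close>

text \<open>By lack of memory, \<open>\<delta> + z\<close> is an independent fresh copy of an exponential variable conditioned to
  exceed \<open>\<delta>\<close>.  Light weights are kept, so light paths are left unchanged; heavy weights become
  independent of the path that was chosen on the basis of \<open>x\<close>.\<close>

definition resampled_quantile :: "real measure \<Rightarrow> real \<Rightarrow> real \<Rightarrow> real \<Rightarrow> real" where
  "resampled_quantile F \<delta> x z = exp_quantile F (if x \<le> \<delta> then x else \<delta> + z)"

locale light_coupling = nonneg_distribution F for F :: "real measure" +
  fixes \<delta> c :: real
  assumes \<delta>_pos: "0 < \<delta>" and c_pos: "0 < c"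
    and quantile_le: "\<And>x. 0 < x \<Longrightarrow> x \<le> \<delta> \<Longrightarrow> exp_quantile F x \<le> c * x"
begin

lemma resampled_nonneg: "0 \<le> resampled_quantile F \<delta> x z"
  unfolding resampled_quantile_def by (rule exp_quantile_nonneg)

lemma measurable_resampled [measurable]:
  "case_prod (resampled_quantile F \<delta>) \<in> borel_measurable (borel \<Otimes>\<^sub>M borel)"
  unfolding resampled_quantile_def by measurable

lemma distr_resampled:
  "distr (Exp1 \<Otimes>\<^sub>M Exp1) borel (case_prod (resampled_quantile F \<delta>)) = F"
proof -
  interpret E: borel_prob Exp1 by (rule borel_prob_Exp1)
  have "distr (Exp1 \<Otimes>\<^sub>M Exp1) borel (\<lambda>(x, z). exp_quantile F (if x \<le> \<delta> then x else \<delta> + z)) = F"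
    using distr_resample_above[OF \<delta>_pos]
    by (intro distr_exp_quantile_of) (auto cong: sets_pair_measure_cong)
  then show ?thesis by (simp add: resampled_quantile_def[abs_def] case_prod_beta)
qed

lemma field_time_resampled_less:
  assumes y: "y \<in> light_event \<delta> H v w t" and pos: "\<forall>e\<in>edges H. 0 < y e" and t: "0 \<le> t"
  shows "field_time H v w (\<lambda>e. resampled_quantile F \<delta> (y e) (z e)) < ereal (c * t)"
proof -
  obtain es where es: "is_path H v es w" "path_time y es < t" and light: "\<And>e. e \<in> set es \<Longrightarrow> y e \<le> \<delta>"
    using light_eventE[OF assms] by blast
  have "path_time (\<lambda>e. resampled_quantile F \<delta> (y e) (z e)) es \<le> path_time (\<lambda>e. c * y e) es"
    using pos is_path_edges[OF es(1)] light
    by (intro path_time_mono) (auto simp: resampled_quantile_def intro!: quantile_le)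
  also have "\<dots> < c * t"
    using es(2) c_pos by (simp add: path_time_cmult)
  finally show ?thesis using es(1) by (auto simp: field_time_less_iff)
qed

lemma measure_light_event_le:
  assumes H: "bounded_degree_graph H" and t: "0 \<le> t"
  shows "measure (iid_field (edges H) Exp1) (light_event \<delta> H v w t) \<le> prob_field_time_less F H v w (c * t)"
proof -
  interpret bounded_degree_graph H by fact
  interpret E: borel_prob Exp1 by (rule borel_prob_Exp1)
  interpret F: borel_prob F by (rule borel_prob)
  let ?\<mu> = "iid_field (edges H) Exp1" and ?F = "iid_field (edges H) F"
  have [measurable]: "field_time H v w \<in> borel_measurable ?F"
    by (rule measurable_field_time[OF borel_prob])
  have "emeasure ?\<mu> (light_event \<delta> H v w t) = (\<integral>\<^sup>+y. indicator (light_event \<delta> H v w t) y \<partial>?\<mu>)"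
    using sets_light_event by simp
  also have "\<dots> \<le> (\<integral>\<^sup>+y. \<integral>\<^sup>+z. indicator {..<ereal (c * t)}
      (field_time H v w (\<lambda>e. resampled_quantile F \<delta> (y e) (z e))) \<partial>?\<mu> \<partial>?\<mu>)"
  proof (rule nn_integral_mono_AE)
    show "AE y in ?\<mu>. indicator (light_event \<delta> H v w t) y \<le> (\<integral>\<^sup>+z. indicator {..<ereal (c * t)}
      (field_time H v w (\<lambda>e. resampled_quantile F \<delta> (y e) (z e))) \<partial>?\<mu>)"
      using AE_iid_Exp1_pos[OF countable_edges]
    proof eventually_elim
      case (elim y)
      show ?case
      proof (cases "y \<in> light_event \<delta> H v w t")
        case True
        have "(\<integral>\<^sup>+z. indicator {..<ereal (c * t)}
            (field_time H v w (\<lambda>e. resampled_quantile F \<delta> (y e) (z e))) \<partial>?\<mu>) = (\<integral>\<^sup>+z. 1 \<partial>?\<mu>)"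
          using field_time_resampled_less[OF True elim t] by (intro nn_integral_cong) auto
        then show ?thesis using True by (simp add: E.pps.emeasure_space_1)
      qed simp
    qed
  qed
  also have "\<dots> = (\<integral>\<^sup>+y. indicator {..<ereal (c * t)} (field_time H v w y) \<partial>?F)"
    by (rule nn_integral_coupled_field_time[OF borel_prob_Exp1 borel_prob_Exp1 borel_prob
          measurable_resampled distr_resampled, symmetric]) simp
  also have "\<dots> = (\<integral>\<^sup>+y. indicator {y \<in> space ?F. field_time H v w y < ereal (c * t)} y \<partial>?F)"
    by (intro nn_integral_cong) (auto simp: indicator_def)
  also have "\<dots> = emeasure ?F {y \<in> space ?F. field_time H v w y < ereal (c * t)}"
    by (subst nn_integral_indicator) auto
  finally show ?thesis
    by (simp add: prob_field_time_less_def E.pps.emeasure_eq_measure F.pps.emeasure_eq_measure)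
qed

text \<open>A heavy weight \<open>x > \<delta>\<close> is replaced by one whose mean \<open>m\<close> is the same for all such \<open>x\<close>, hence is at
  most \<open>(m / \<delta>) x\<close>.  Finiteness of \<open>m\<close> is inherited from \<open>F\<close>: the heavy part alone contributes
  \<open>exp(-\<delta>) m\<close> to the mean of \<open>F\<close>.\<close>

lemma resampled_mean_le:
  assumes int: "integrable F (\<lambda>x. x)"
  shows "\<exists>K>0. \<forall>x>0. (\<integral>\<^sup>+z. ennreal (resampled_quantile F \<delta> x z) \<partial>Exp1) \<le> ennreal (K * x)"
proof -
  interpret E: borel_prob Exp1 by (rule borel_prob_Exp1)
  define m where "m = (\<integral>\<^sup>+z. ennreal (exp_quantile F (\<delta> + z)) \<partial>Exp1)"
  have sfE: "sigma_finite_measure Exp1" by (rule prob_space_imp_sigma_finite) (rule E.prob_space_axioms)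
  have [measurable]: "case_prod (resampled_quantile F \<delta>) \<in> borel_measurable (Exp1 \<Otimes>\<^sub>M Exp1)" by simp
  have [measurable]: "(\<lambda>p. ennreal (case_prod (resampled_quantile F \<delta>) p)) \<in> borel_measurable (Exp1 \<Otimes>\<^sub>M Exp1)"
    by measurable
  have "(\<integral>\<^sup>+x. ennreal x \<partial>F) = (\<integral>\<^sup>+p. ennreal (case_prod (resampled_quantile F \<delta>) p) \<partial>(Exp1 \<Otimes>\<^sub>M Exp1))"
    by (subst distr_resampled[symmetric], subst nn_integral_distr) auto
  also have "\<dots> = (\<integral>\<^sup>+x. \<integral>\<^sup>+z. ennreal (resampled_quantile F \<delta> x z) \<partial>Exp1 \<partial>Exp1)"
    by (subst sigma_finite_measure.nn_integral_fst[OF sfE, symmetric]) auto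
  also have "\<dots> \<ge> (\<integral>\<^sup>+x. m * indicator {\<delta><..} x \<partial>Exp1)"
    by (intro nn_integral_mono) (auto simp: m_def resampled_quantile_def indicator_def)
  also have "(\<integral>\<^sup>+x. m * indicator {\<delta><..} x \<partial>Exp1) = m * ennreal (exp (- \<delta>))"
    using measure_Exp1(2)[of \<delta>] \<delta>_pos by (simp add: nn_integral_cmult_indicator E.emeasure_eq_measure)
  finally have "m * ennreal (exp (- \<delta>)) \<le> (\<integral>\<^sup>+x. ennreal x \<partial>F)" .
  also have "\<dots> \<le> (\<integral>\<^sup>+x. ennreal (norm x) \<partial>F)"
    by (intro nn_integral_mono ennreal_leI) auto
  also have "\<dots> < \<infinity>" using int by (simp add: integrable_iff_bounded)
  finally have "m * ennreal (exp (- \<delta>)) < \<infinity>" .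
  then have "m \<noteq> top" by (auto simp: ennreal_top_mult)
  then obtain r where r: "0 \<le> r" "m = ennreal r" by (cases m) auto
  define K where "K = max c (r / \<delta>)"
  have "(\<integral>\<^sup>+z. ennreal (resampled_quantile F \<delta> x z) \<partial>Exp1) \<le> ennreal (K * x)" if x: "0 < x" for x
  proof (cases "x \<le> \<delta>")
    case True
    then have "(\<integral>\<^sup>+z. ennreal (resampled_quantile F \<delta> x z) \<partial>Exp1) = ennreal (exp_quantile F x)"
      using E.emeasure_space_1 by (simp add: resampled_quantile_def)
    also have "\<dots> \<le> ennreal (K * x)"
    proof (rule ennreal_leI)
      have "exp_quantile F x \<le> c * x" using x True by (rule quantile_le)
      also have "\<dots> \<le> K * x" using x by (simp add: K_def)
      finally show "exp_quantile F x \<le> K * x" .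
    qed
    finally show ?thesis .
  next
    case False
    have "r = r / \<delta> * \<delta>" using \<delta>_pos by simp
    also have "\<dots> \<le> K * x"
      using False \<delta>_pos r(1) c_pos by (intro mult_mono) (auto simp: K_def)
    finally have "r \<le> K * x" .
    then show ?thesis
      using False r(2) by (auto simp: resampled_quantile_def m_def[symmetric] intro!: ennreal_leI)
  qed
  moreover have "0 < K" using c_pos by (auto simp: K_def)
  ultimately show ?thesis by blast
qed

text \<open>The passage time is at most the length of any path, whose mean given \<open>y\<close> is the sum of the means
  over its edges; the infimum over the paths is then taken on the right-hand side.\<close>

lemma resampled_field_time_mean_le:
  assumes H: "bounded_degree_graph H" and K: "0 < K"
    and mean: "\<And>x. 0 < x \<Longrightarrow> (\<integral>\<^sup>+z. ennreal (resampled_quantile F \<delta> x z) \<partial>Exp1) \<le> ennreal (K * x)"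
    and pos: "\<forall>e\<in>edges H. 0 < y e"
  shows "(\<integral>\<^sup>+z. e2ennreal (field_time H v w (\<lambda>e. resampled_quantile F \<delta> (y e) (z e))) \<partial>iid_field (edges H) Exp1)
    \<le> ennreal K * e2ennreal (field_time H v w y)" (is "?I \<le> _")
proof -
  interpret bounded_degree_graph H by fact
  interpret E: borel_prob Exp1 by (rule borel_prob_Exp1)
  let ?\<mu> = "iid_field (edges H) Exp1"
  let ?R = "resampled_quantile F \<delta>"
  have meas: "(\<lambda>z. ennreal (?R x z)) \<in> borel_measurable borel" for x by measurable
  have meas': "(\<lambda>z. ennreal (?R (y e) (z e))) \<in> borel_measurable ?\<mu>" if "e \<in> edges H" for e
    using E.measurable_coordinate[OF that] meas by (rule measurable_compose)
  have along: "(\<integral>\<^sup>+z. ennreal (path_time (\<lambda>e. ?R (y e) (z e)) es) \<partial>?\<mu>) \<le> ennreal (K * path_time y es)"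
    if "set es \<subseteq> edges H" for es
    using that
  proof (induction es)
    case Nil
    then show ?case by (simp add: path_time_def)
  next
    case (Cons e es)
    have e: "e \<in> edges H" using Cons.prems by simp
    have cons: "path_time f (e # es) = f e + path_time f es" for f
      by (simp add: path_time_def)
    have nonneg: "0 \<le> path_time (\<lambda>e. ?R (y e) (z e)) es" for z
      by (rule path_time_nonneg) (rule resampled_nonneg)
    have ypos: "0 \<le> path_time y es"
      by (rule path_time_nonneg) (use pos Cons.prems in \<open>auto intro: less_imp_le\<close>)
    have meas_tail: "(\<lambda>z. ennreal (path_time (\<lambda>e. ?R (y e) (z e)) es)) \<in> borel_measurable ?\<mu>"
    proof -
      have "ennreal (path_time (\<lambda>e. ?R (y e) (z e)) es) = (\<Sum>e\<leftarrow>es. ennreal (?R (y e) (z e)))" for z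
        unfolding path_time_def
      proof (induction es)
        case (Cons a es)
        have "0 \<le> (\<Sum>e\<leftarrow>es. ?R (y e) (z e))"
          by (rule sum_list_nonneg) (auto simp: resampled_nonneg)
        with Cons show ?case by (simp add: ennreal_plus resampled_nonneg)
      qed simp
      moreover have "(\<lambda>z. \<Sum>e\<leftarrow>es. ennreal (?R (y e) (z e))) \<in> borel_measurable ?\<mu>"
        using Cons.prems by (induction es) (auto intro!: borel_measurable_add meas')
      ultimately show ?thesis by simp
    qed
    have "(\<integral>\<^sup>+z. ennreal (path_time (\<lambda>e. ?R (y e) (z e)) (e # es)) \<partial>?\<mu>)
        = (\<integral>\<^sup>+z. ennreal (?R (y e) (z e)) \<partial>?\<mu>) + (\<integral>\<^sup>+z. ennreal (path_time (\<lambda>e. ?R (y e) (z e)) es) \<partial>?\<mu>)"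
      using e by (subst nn_integral_add[symmetric])
        (auto simp: cons nonneg resampled_nonneg meas' meas_tail)
    also have "(\<integral>\<^sup>+z. ennreal (?R (y e) (z e)) \<partial>?\<mu>) = (\<integral>\<^sup>+x. ennreal (?R (y e) x) \<partial>Exp1)"
      using E.nn_integral_iid_field_prod[of "{e}" "edges H" "\<lambda>_ x. ennreal (?R (y e) x)"] e meas by simp
    also have "\<dots> \<le> ennreal (K * y e)" using mean pos e by auto
    also have "(\<integral>\<^sup>+z. ennreal (path_time (\<lambda>e. ?R (y e) (z e)) es) \<partial>?\<mu>) \<le> ennreal (K * path_time y es)"
      using Cons by simp
    also have "ennreal (K * y e) + ennreal (K * path_time y es) = ennreal (K * path_time y (e # es))"
      using K ypos pos e by (subst ennreal_plus[symmetric]) (auto simp: cons distrib_left less_imp_le)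
    finally show ?case by (simp add: add_mono)
  qed
  have "0 \<le> field_time H v w y" by (rule field_time_nonneg) (use pos in \<open>auto intro: less_imp_le\<close>)
  then consider "field_time H v w y = \<infinity>" | r where "field_time H v w y = ereal r" "0 \<le> r"
    by (cases "field_time H v w y") auto
  then show ?thesis
  proof cases
    case 1
    then show ?thesis using K by (simp add: ennreal_mult_top)
  next
    case (2 r)
    \<comment> \<open>The infimum need not be attained, so paths of length less than \<open>r + \<epsilon> / K\<close> are used.\<close>
    have "?I \<le> ennreal (K * r)"
    proof (rule ennreal_le_epsilon)
      fix \<epsilon> :: real assume \<epsilon>: "0 < \<epsilon>"
      have "field_time H v w y < ereal (r + \<epsilon> / K)" using 2 \<epsilon> K by simp
      then obtain es where es: "is_path H v es w" "path_time y es < r + \<epsilon> / K"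
        by (auto simp: field_time_less_iff)
      have "?I \<le> (\<integral>\<^sup>+z. ennreal (path_time (\<lambda>e. ?R (y e) (z e)) es) \<partial>?\<mu>)"
        using field_time_le[OF es(1)] by (intro nn_integral_mono) (simp flip: e2ennreal_ereal add: e2ennreal_mono)
      also have "\<dots> \<le> ennreal (K * path_time y es)" by (rule along) (rule is_path_edges[OF es(1)])
      also have "\<dots> \<le> ennreal (K * (r + \<epsilon> / K))"
        using es(2) K by (intro ennreal_leI mult_left_mono) auto
      also have "\<dots> = ennreal (K * r) + ennreal \<epsilon>"
        using K 2 \<epsilon> by (simp add: distrib_left ennreal_plus)
      finally show "?I \<le> ennreal (K * r) + ennreal \<epsilon>" .
    qed
    also have "\<dots> = ennreal K * e2ennreal (field_time H v w y)"
      using 2 K by (simp add: ennreal_mult)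
    finally show ?thesis .
  qed
qed

text \<open>On the light event the coupled passage time is below \<open>c t\<close> for every \<open>z\<close>, so the left-hand side
  only sees the complement of that event, where the conditional mean bound applies.\<close>

lemma upper_tail_mean:
  assumes H: "bounded_degree_graph H" and K: "0 < K" and t: "0 \<le> t"
    and mean: "\<And>x. 0 < x \<Longrightarrow> (\<integral>\<^sup>+z. ennreal (resampled_quantile F \<delta> x z) \<partial>Exp1) \<le> ennreal (K * x)"
  shows "(\<integral>\<^sup>+x. e2ennreal (field_time H v w x) * indicator {ereal (c * t)..} (field_time H v w x) \<partial>iid_field (edges H) F)
    \<le> ennreal K * (\<integral>\<^sup>+y. e2ennreal (field_time H v w y) * indicator (- light_event \<delta> H v w t) y \<partial>iid_field (edges H) Exp1)"
proof -
  interpret bounded_degree_graph H by fact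
  interpret E: borel_prob Exp1 by (rule borel_prob_Exp1)
  let ?\<mu> = "iid_field (edges H) Exp1"
  let ?R = "resampled_quantile F \<delta>"
  let ?g = "\<lambda>r. e2ennreal r * indicator {ereal (c * t)..} r"
  let ?B = "light_event \<delta> H v w t"
  note [measurable] = measurable_field_time[OF borel_prob_Exp1] sets_light_event
  have [measurable]: "- ?B \<inter> space ?\<mu> \<in> sets ?\<mu>"
    using sets.compl_sets[OF sets_light_event] by (simp add: Diff_eq Int_commute)
  have m: "(\<lambda>y. e2ennreal (field_time H v w y) * indicator (- ?B) y) \<in> borel_measurable ?\<mu>"
    by measurable
  have "(\<integral>\<^sup>+x. ?g (field_time H v w x) \<partial>iid_field (edges H) F)
      = (\<integral>\<^sup>+y. \<integral>\<^sup>+z. ?g (field_time H v w (\<lambda>e. ?R (y e) (z e))) \<partial>?\<mu> \<partial>?\<mu>)"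
    by (rule nn_integral_coupled_field_time[OF borel_prob_Exp1 borel_prob_Exp1 borel_prob
          measurable_resampled distr_resampled]) measurable
  also have "\<dots> \<le> (\<integral>\<^sup>+y. ennreal K * (e2ennreal (field_time H v w y) * indicator (- ?B) y) \<partial>?\<mu>)"
  proof (rule nn_integral_mono_AE)
    show "AE y in ?\<mu>. (\<integral>\<^sup>+z. ?g (field_time H v w (\<lambda>e. ?R (y e) (z e))) \<partial>?\<mu>)
        \<le> ennreal K * (e2ennreal (field_time H v w y) * indicator (- ?B) y)"
      using AE_iid_Exp1_pos[OF countable_edges]
    proof eventually_elim
      case (elim y)
      show ?case
      proof (cases "y \<in> ?B")
        case True
        have "(\<integral>\<^sup>+z. ?g (field_time H v w (\<lambda>e. ?R (y e) (z e))) \<partial>?\<mu>) = (\<integral>\<^sup>+z. 0 \<partial>?\<mu>)"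
          using field_time_resampled_less[OF True elim t]
          by (intro nn_integral_cong) (auto simp: indicator_def linorder_not_le[symmetric] simp del: linorder_not_le)
        then show ?thesis by simp
      next
        case False
        have "(\<integral>\<^sup>+z. ?g (field_time H v w (\<lambda>e. ?R (y e) (z e))) \<partial>?\<mu>)
            \<le> (\<integral>\<^sup>+z. e2ennreal (field_time H v w (\<lambda>e. ?R (y e) (z e))) \<partial>?\<mu>)"
          by (intro nn_integral_mono) (auto simp: indicator_def)
        also have "\<dots> \<le> ennreal K * e2ennreal (field_time H v w y)"
          by (rule resampled_field_time_mean_le[OF H K mean elim])
        finally show ?thesis using False by simp
      qed
    qed
  qed
  also have "\<dots> = ennreal K * (\<integral>\<^sup>+y. e2ennreal (field_time H v w y) * indicator (- ?B) y \<partial>?\<mu>)"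
    by (rule nn_integral_cmult) (rule m)
  finally show ?thesis .
qed

end

section \<open>Modes of convergence\<close>

text \<open>Convergence in probability is treated through its two tails because they have different proofs:
  the lower tail is compared directly, the upper one needs light paths.\<close>

lemma tendsto_in_prob_iff_tails:
  assumes H: "\<And>n. bounded_degree_graph (H n)" and F: "borel_prob F"
    and iid: "\<And>n. iid_edge_times (M n) F (H n) (X n)"
  shows "tendsto_in_prob M (\<lambda>n. passage_time (H n) (X n) (v n) (w n)) c \<longleftrightarrow>
    (\<forall>\<epsilon>>0. (\<lambda>n. prob_field_time_less F (H n) (v n) (w n) (c - \<epsilon>)) \<longlonglongrightarrow> 0 \<and>
            (\<lambda>n. prob_field_time_less F (H n) (v n) (w n) (c + \<epsilon>)) \<longlonglongrightarrow> 1)"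
    (is "_ = ?tails")
proof -
  let ?T = "\<lambda>n. passage_time (H n) (X n) (v n) (w n)"
  let ?D = "\<lambda>\<epsilon> n. {\<omega> \<in> space (M n). \<bar>?T n \<omega> - ereal c\<bar> > ereal \<epsilon>}"
  let ?p = "\<lambda>s n. prob_field_time_less F (H n) (v n) (w n) s"
  have prob: "prob_space (M n)" for n using iid by (simp add: iid_edge_times_def)
  have [measurable]: "?T n \<in> borel_measurable (M n)" for n
    by (rule bounded_degree_graph.borel_measurable_passage_time[OF H iid])
  have p: "measure (M n) {\<omega> \<in> space (M n). ?T n \<omega> < ereal s} = ?p s n" for n s
    by (rule bounded_degree_graph.measure_passage_time_less[OF H iid F])
  have compl: "measure (M n) {\<omega> \<in> space (M n). \<not> ?T n \<omega> < ereal s} = 1 - ?p s n" for n s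
  proof -
    interpret prob_space "M n" by (rule prob)
    have "{\<omega> \<in> space (M n). \<not> ?T n \<omega> < ereal s} = space (M n) - {\<omega> \<in> space (M n). ?T n \<omega> < ereal s}"
      by auto
    also have "prob \<dots> = 1 - prob {\<omega> \<in> space (M n). ?T n \<omega> < ereal s}"
      by (rule prob_compl) measurable
    finally show ?thesis by (simp only: p)
  qed
  have up: "measure (M n) (?D \<epsilon> n) \<le> ?p (c - \<epsilon>) n + (1 - ?p (c + \<epsilon>) n)" for n \<epsilon>
  proof -
    interpret prob_space "M n" by (rule prob)
    have "?T n \<omega> < ereal (c - \<epsilon>) \<or> \<not> ?T n \<omega> < ereal (c + \<epsilon>)"
      if "\<bar>?T n \<omega> - ereal c\<bar> > ereal \<epsilon>" for \<omega>
      using that by (cases "?T n \<omega>") auto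
    then have "prob (?D \<epsilon> n) \<le> prob ({\<omega> \<in> space (M n). ?T n \<omega> < ereal (c - \<epsilon>)}
        \<union> {\<omega> \<in> space (M n). \<not> ?T n \<omega> < ereal (c + \<epsilon>)})"
      by (intro finite_measure_mono) auto
    also have "\<dots> \<le> prob {\<omega> \<in> space (M n). ?T n \<omega> < ereal (c - \<epsilon>)}
        + prob {\<omega> \<in> space (M n). \<not> ?T n \<omega> < ereal (c + \<epsilon>)}"
      by (rule measure_Un_le) measurable
    finally show ?thesis by (simp only: p compl)
  qed
  \<comment> \<open>The deviation in \<open>?D\<close> is strict while \<open>T \<ge> c + \<epsilon>\<close> only gives deviation at least \<open>\<epsilon>\<close>; hence \<open>\<epsilon> / 2\<close>.\<close>
  have low: "?p (c - \<epsilon>) n \<le> measure (M n) (?D (\<epsilon> / 2) n)"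
    and high: "1 - ?p (c + \<epsilon>) n \<le> measure (M n) (?D (\<epsilon> / 2) n)" if \<epsilon>: "0 < \<epsilon>" for n \<epsilon>
  proof -
    interpret prob_space "M n" by (rule prob)
    have D: "?D (\<epsilon> / 2) n \<in> events" by measurable
    have 1: "\<bar>?T n \<omega> - ereal c\<bar> > ereal (\<epsilon> / 2)" if "?T n \<omega> < ereal (c - \<epsilon>)" for \<omega>
      using that \<epsilon> by (cases "?T n \<omega>") auto
    have 2: "\<bar>?T n \<omega> - ereal c\<bar> > ereal (\<epsilon> / 2)" if "\<not> ?T n \<omega> < ereal (c + \<epsilon>)" for \<omega>
      using that \<epsilon> by (cases "?T n \<omega>") auto
    show "?p (c - \<epsilon>) n \<le> prob (?D (\<epsilon> / 2) n)"
      unfolding p[symmetric] using 1 D by (intro finite_measure_mono) auto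
    show "1 - ?p (c + \<epsilon>) n \<le> prob (?D (\<epsilon> / 2) n)"
      unfolding compl[symmetric] using 2 D by (intro finite_measure_mono) auto
  qed
  show ?thesis
  proof
    assume L: "tendsto_in_prob M ?T c"
    show ?tails
    proof (intro allI impI conjI)
      fix \<epsilon> :: real assume \<epsilon>: "0 < \<epsilon>"
      have D: "(\<lambda>n. measure (M n) (?D (\<epsilon> / 2) n)) \<longlonglongrightarrow> 0"
        using L \<epsilon> unfolding tendsto_in_prob_def by simp
      show "?p (c - \<epsilon>) \<longlonglongrightarrow> 0"
        by (rule tendsto_sandwich[OF _ _ tendsto_const D])
          (simp_all add: low[OF \<epsilon>] prob_field_time_less_bounds[OF F])
      have "(\<lambda>n. 1 - ?p (c + \<epsilon>) n) \<longlonglongrightarrow> 0"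
        by (rule tendsto_sandwich[OF _ _ tendsto_const D])
          (simp_all add: high[OF \<epsilon>, simplified] prob_field_time_less_bounds[OF F])
      then have "(\<lambda>n. 1 - (1 - ?p (c + \<epsilon>) n)) \<longlonglongrightarrow> 1 - 0"
        by (intro tendsto_diff tendsto_const)
      then show "?p (c + \<epsilon>) \<longlonglongrightarrow> 1" by simp
    qed
  next
    assume R: ?tails
    show "tendsto_in_prob M ?T c"
      unfolding tendsto_in_prob_def
    proof (intro allI impI)
      fix \<epsilon> :: real assume \<epsilon>: "0 < \<epsilon>"
      have "(\<lambda>n. ?p (c - \<epsilon>) n + (1 - ?p (c + \<epsilon>) n)) \<longlonglongrightarrow> 0 + (1 - 1)"
        using R \<epsilon> by (intro tendsto_add tendsto_diff tendsto_const) auto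
      then have "(\<lambda>n. ?p (c - \<epsilon>) n + (1 - ?p (c + \<epsilon>) n)) \<longlonglongrightarrow> 0" by simp
      then show "(\<lambda>n. measure (M n) (?D \<epsilon> n)) \<longlonglongrightarrow> 0"
        by (rule tendsto_sandwich[OF _ _ tendsto_const, rotated 2]) (simp_all only: up measure_nonneg eventually_True)
    qed
  qed
qed

lemma tendsto_in_L1_imp_in_prob:
  assumes M: "\<And>n. prob_space (M n)" and Y [measurable]: "\<And>n. Y n \<in> borel_measurable (M n)"
    and L: "tendsto_in_L1 M Y c"
  shows "tendsto_in_prob M Y c"
  unfolding tendsto_in_prob_def
proof (intro allI impI)
  fix \<epsilon> :: real assume \<epsilon>: "0 < \<epsilon>"
  let ?I = "\<lambda>n. \<integral>\<^sup>+ \<omega>. e2ennreal \<bar>Y n \<omega> - ereal c\<bar> \<partial>M n"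
  let ?D = "\<lambda>n. {\<omega> \<in> space (M n). \<bar>Y n \<omega> - ereal c\<bar> > ereal \<epsilon>}"
  have le: "emeasure (M n) (?D n) \<le> ennreal (1 / \<epsilon>) * ?I n" for n
  proof -
    have "1 \<le> ennreal (1 / \<epsilon>) * e2ennreal \<bar>r - ereal c\<bar>" if r: "ereal \<epsilon> < \<bar>r - ereal c\<bar>" for r :: ereal
    proof -
      have "1 = ennreal (1 / \<epsilon>) * ennreal \<epsilon>" using \<epsilon> by (simp flip: ennreal_mult)
      also have "ennreal \<epsilon> \<le> e2ennreal \<bar>r - ereal c\<bar>"
        using r by (simp flip: e2ennreal_ereal add: e2ennreal_mono)
      finally show ?thesis by (simp add: mult_left_mono)
    qed
    then have "emeasure (M n) (?D n)
        \<le> emeasure (M n) {\<omega> \<in> space (M n). 1 \<le> ennreal (1 / \<epsilon>) * e2ennreal \<bar>Y n \<omega> - ereal c\<bar>}"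
      by (intro emeasure_mono) auto
    also have "\<dots> \<le> ennreal (1 / \<epsilon>) * (\<integral>\<^sup>+ \<omega>. e2ennreal \<bar>Y n \<omega> - ereal c\<bar> * indicator (space (M n)) \<omega> \<partial>M n)"
      by (rule nn_integral_Markov_inequality) auto
    also have "(\<integral>\<^sup>+ \<omega>. e2ennreal \<bar>Y n \<omega> - ereal c\<bar> * indicator (space (M n)) \<omega> \<partial>M n) = ?I n"
      by (intro nn_integral_cong) simp
    finally show ?thesis .
  qed
  have "(\<lambda>n. ennreal (1 / \<epsilon>) * ?I n) \<longlonglongrightarrow> ennreal (1 / \<epsilon>) * 0"
    using L unfolding tendsto_in_L1_def by (intro ennreal_tendsto_cmult) auto
  then have "(\<lambda>n. ennreal (1 / \<epsilon>) * ?I n) \<longlonglongrightarrow> 0" by simp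
  then have "(\<lambda>n. emeasure (M n) (?D n)) \<longlonglongrightarrow> 0"
    by (rule tendsto_sandwich[OF _ _ tendsto_const, rotated 2]) (simp_all only: le zero_le eventually_True)
  then have "(\<lambda>n. enn2real (emeasure (M n) (?D n))) \<longlonglongrightarrow> 0"
    using tendsto_enn2real[of "\<lambda>n. emeasure (M n) (?D n)" 0 sequentially] by simp
  then show "(\<lambda>n. measure (M n) (?D n)) \<longlonglongrightarrow> 0"
    by (simp add: measure_def)
qed

text \<open>As for the Ky Fan metric, one chooses \<open>\<epsilon> n\<close> to be nearly the smallest \<open>e\<close> with \<open>p n e \<le> e\<close>:
  both \<open>\<epsilon> n\<close> and \<open>p n (\<epsilon> n)\<close> are then small.\<close>

lemma diagonal_null_sequence:
  fixes p :: "nat \<Rightarrow> real \<Rightarrow> real"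
  assumes lim: "\<And>\<epsilon>. 0 < \<epsilon> \<Longrightarrow> (\<lambda>n. p n \<epsilon>) \<longlonglongrightarrow> 0" and p: "\<And>n \<epsilon>. 0 \<le> p n \<epsilon>" "\<And>n \<epsilon>. p n \<epsilon> \<le> 1"
  shows "\<exists>\<epsilon>. \<epsilon> \<longlonglongrightarrow> 0 \<and> (\<lambda>n. p n (\<epsilon> n)) \<longlonglongrightarrow> 0"
proof -
  define S where "S n = {e. 0 < e \<and> p n e \<le> e}" for n
  have ne: "1 \<in> S n" for n using p by (simp add: S_def)
  have bdd: "bdd_below (S n)" for n by (intro bdd_belowI[of _ 0]) (auto simp: S_def)
  have "\<exists>e\<in>S n. e < Inf (S n) + 1 / Suc n" for n
  proof (rule cInf_lessD)
    show "S n \<noteq> {}" using ne by blast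
  qed simp
  then obtain \<epsilon> where \<epsilon>: "\<And>n. \<epsilon> n \<in> S n" "\<And>n. \<epsilon> n < Inf (S n) + 1 / Suc n" by metis
  have "(\<lambda>n. Inf (S n)) \<longlonglongrightarrow> 0"
  proof (rule LIMSEQ_I)
    fix r :: real assume r: "0 < r"
    have "\<forall>\<^sub>F n in sequentially. p n (r / 2) < r / 2"
      by (rule order_tendstoD(2)[OF lim]) (use r in auto)
    then obtain N where N: "\<And>n. N \<le> n \<Longrightarrow> p n (r / 2) < r / 2"
      by (auto simp: eventually_sequentially)
    have "norm (Inf (S n) - 0) < r" if "N \<le> n" for n
    proof -
      have "Inf (S n) \<le> r / 2"
        using N[OF that] r by (intro cInf_lower bdd) (auto simp: S_def)
      moreover have "0 \<le> Inf (S n)"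
        by (rule cInf_greatest) (use ne[of n] in blast, simp add: S_def)
      ultimately show ?thesis using r by simp
    qed
    then show "\<exists>N. \<forall>n\<ge>N. norm (Inf (S n) - 0) < r" by blast
  qed
  then have "(\<lambda>n. Inf (S n) + 1 / Suc n) \<longlonglongrightarrow> 0 + 0"
    by (intro tendsto_add LIMSEQ_Suc[OF lim_1_over_n])
  then have lim0: "(\<lambda>n. Inf (S n) + 1 / Suc n) \<longlonglongrightarrow> 0" by simp
  have \<epsilon>S: "0 \<le> \<epsilon> n" "p n (\<epsilon> n) \<le> \<epsilon> n" "\<epsilon> n \<le> Inf (S n) + 1 / Suc n" for n
    using \<epsilon>(1)[of n] \<epsilon>(2)[of n] by (auto simp: S_def)
  have \<epsilon>0: "\<epsilon> \<longlonglongrightarrow> 0"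
    by (rule tendsto_sandwich[OF _ _ tendsto_const lim0]) (simp_all only: \<epsilon>S eventually_True)
  moreover have "(\<lambda>n. p n (\<epsilon> n)) \<longlonglongrightarrow> 0"
    by (rule tendsto_sandwich[OF _ _ tendsto_const \<epsilon>0]) (simp_all only: \<epsilon>S p eventually_True)
  ultimately show ?thesis by blast
qed

section \<open>Universality\<close>

lemma lower_tail_vanishes:
  fixes H :: "nat \<Rightarrow> ('v, 'e) mixed_graph"
  assumes F: "F \<in> class_C \<rho>" "0 < \<rho>" and H: "\<And>n. bounded_degree_graph (H n)" and s: "\<rho> * s' < s"
    and lim: "(\<lambda>n. prob_field_time_less Exp1 (H n) (v n) (w n) s) \<longlonglongrightarrow> 0"
  shows "(\<lambda>n. prob_field_time_less F (H n) (v n) (w n) s') \<longlonglongrightarrow> 0"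
proof -
  interpret nonneg_distribution F using F(1) by (rule class_C_nonneg_distribution)
  obtain K where K: "\<forall>(H :: ('v, 'e) mixed_graph) v w. bounded_degree_graph H \<longrightarrow>
      prob_field_time_less F H v w s' \<le> K * prob_field_time_less Exp1 H v w s"
    using lower_tail[OF F s, where 'v = 'v and 'e = 'e] by (rule exE)
  have limK: "(\<lambda>n. K * prob_field_time_less Exp1 (H n) (v n) (w n) s) \<longlonglongrightarrow> 0"
    using tendsto_mult[OF tendsto_const lim, of K] by simp
  show ?thesis
    by (rule tendsto_sandwich[OF _ _ tendsto_const limK])
      (simp_all add: K H prob_field_time_less_bounds[OF borel_prob])
qed

text \<open>The order of choices matters: first \<open>\<eta>\<close> so that \<open>(1 + \<eta>) (t + \<eta>) / \<rho> < s\<close>, then \<open>\<delta>\<close> so that the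
  quantile bound with \<open>c = (1 + \<eta>) / \<rho>\<close> holds up to \<open>\<delta>\<close>, and finally \<open>t'\<close> between \<open>t\<close> and
  \<open>t + \<eta>\<close> for this \<open>\<delta>\<close>.\<close>

lemma exists_light_coupling:
  fixes H :: "nat \<Rightarrow> ('v, 'e) mixed_graph"
  assumes F: "F \<in> class_C \<rho>" and \<rho>: "0 < \<rho>" and H: "\<And>n. bounded_degree_graph (H n)" and t: "0 \<le> t"
    and s: "t / \<rho> < s"
    and below: "\<And>\<epsilon>. 0 < \<epsilon> \<Longrightarrow> (\<lambda>n. prob_field_time_less Exp1 (H n) (v n) (w n) (t - \<epsilon>)) \<longlonglongrightarrow> 0"
    and above: "\<And>\<epsilon>. 0 < \<epsilon> \<Longrightarrow> (\<lambda>n. prob_field_time_less Exp1 (H n) (v n) (w n) (t + \<epsilon>)) \<longlonglongrightarrow> 1"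
  shows "\<exists>\<delta> c t'. light_coupling F \<delta> c \<and> 0 \<le> t' \<and> t / \<rho> \<le> c * t' \<and> c * t' < s \<and>
    (\<lambda>n. measure (iid_field (edges (H n)) Exp1) (light_event \<delta> (H n) (v n) (w n) t')) \<longlonglongrightarrow> 1"
proof -
  interpret E: borel_prob Exp1 by (rule borel_prob_Exp1)
  have lim: "((\<lambda>\<eta>. (1 + \<eta>) / \<rho> * (t + \<eta>)) \<longlongrightarrow> (1 + 0) / \<rho> * (t + 0)) (at_right 0)"
    using \<rho> by (intro tendsto_intros) auto
  have "(1 + 0) / \<rho> * (t + 0) < s" using s by simp
  from exists_small_parameter[OF lim this] obtain \<eta>
    where \<eta>: "0 < \<eta>" "\<eta> < 1" "(1 + \<eta>) / \<rho> * (t + \<eta>) < s" by blast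
  define c where "c = (1 + \<eta>) / \<rho>"
  have c: "1 / \<rho> \<le> c" "0 < c" using \<eta> \<rho> by (auto simp: c_def divide_right_mono)
  obtain \<delta> where \<delta>: "0 < \<delta>" "\<forall>x>0. x \<le> \<delta> \<longrightarrow> exp_quantile F x \<le> c * x"
    using exp_quantile_near_zero[OF F \<rho> \<eta>(1)] unfolding c_def by blast
  obtain t' K where t': "t < t'" "t' < t + \<eta>" and
    K: "\<forall>(H :: ('v, 'e) mixed_graph) v w. bounded_degree_graph H \<longrightarrow>
      prob_field_time_less Exp1 H v w t' \<le> measure (iid_field (edges H) Exp1) (light_event \<delta> H v w t')
      + K * prob_field_time_less Exp1 H v w (t - \<delta> / 4)"
    using light_paths[OF \<delta>(1) \<eta>(1) t] by blast
  let ?L = "\<lambda>n. measure (iid_field (edges (H n)) Exp1) (light_event \<delta> (H n) (v n) (w n) t')"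
  let ?p = "\<lambda>s n. prob_field_time_less Exp1 (H n) (v n) (w n) s"
  have "?p (t + (t' - t)) \<longlonglongrightarrow> 1" using t' by (intro above) simp
  moreover have "?p (t - \<delta> / 4) \<longlonglongrightarrow> 0" using \<delta> by (intro below) simp
  ultimately have "(\<lambda>n. ?p t' n - K * ?p (t - \<delta> / 4) n) \<longlonglongrightarrow> 1 - K * 0"
    by (intro tendsto_diff tendsto_mult tendsto_const) auto
  then have lim1: "(\<lambda>n. ?p t' n - K * ?p (t - \<delta> / 4) n) \<longlonglongrightarrow> 1" by simp
  have low: "?p t' n - K * ?p (t - \<delta> / 4) n \<le> ?L n" for n
    using K H[of n] by (simp add: diff_le_eq)
  have "?L n \<le> 1" for n by (rule E.pps.prob_le_1)
  with low have "?L \<longlonglongrightarrow> 1"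
    by (intro tendsto_sandwich[OF _ _ lim1 tendsto_const]) (simp_all only: eventually_True)
  moreover have "light_coupling F \<delta> c"
    using class_C_nonneg_distribution[OF F] \<delta> c
    by (simp add: light_coupling_def light_coupling_axioms_def)
  moreover have "t / \<rho> \<le> c * t'"
    using mult_mono[OF c(1), of t t'] t t' c by simp
  moreover have "c * t' < s"
  proof -
    have "c * t' \<le> c * (t + \<eta>)" using t' c by (intro mult_left_mono) auto
    then show ?thesis using \<eta>(3) by (simp add: c_def)
  qed
  ultimately show ?thesis using t t' by (intro exI[of _ \<delta>] exI[of _ c] exI[of _ t']) auto
qed

lemma upper_tail_vanishes:
  fixes H :: "nat \<Rightarrow> ('v, 'e) mixed_graph"
  assumes F: "F \<in> class_C \<rho>" and \<rho>: "0 < \<rho>" and H: "\<And>n. bounded_degree_graph (H n)" and t: "0 \<le> t"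
    and s: "t / \<rho> < s"
    and below: "\<And>\<epsilon>. 0 < \<epsilon> \<Longrightarrow> (\<lambda>n. prob_field_time_less Exp1 (H n) (v n) (w n) (t - \<epsilon>)) \<longlonglongrightarrow> 0"
    and above: "\<And>\<epsilon>. 0 < \<epsilon> \<Longrightarrow> (\<lambda>n. prob_field_time_less Exp1 (H n) (v n) (w n) (t + \<epsilon>)) \<longlonglongrightarrow> 1"
  shows "(\<lambda>n. prob_field_time_less F (H n) (v n) (w n) s) \<longlonglongrightarrow> 1"
proof -
  obtain \<delta> c t' where "light_coupling F \<delta> c" and t': "0 \<le> t'" "c * t' < s" and
    light: "(\<lambda>n. measure (iid_field (edges (H n)) Exp1) (light_event \<delta> (H n) (v n) (w n) t')) \<longlonglongrightarrow> 1"
    using exists_light_coupling[OF assms] by blast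
  interpret light_coupling F \<delta> c by fact
  interpret F: borel_prob F by (rule borel_prob)
  have "measure (iid_field (edges (H n)) Exp1) (light_event \<delta> (H n) (v n) (w n) t')
      \<le> prob_field_time_less F (H n) (v n) (w n) s" for n
  proof -
    interpret bounded_degree_graph "H n" by (rule H)
    have [measurable]: "field_time (H n) (v n) (w n) \<in> borel_measurable (iid_field (edges (H n)) F)"
      by (rule measurable_field_time[OF borel_prob])
    have "measure (iid_field (edges (H n)) Exp1) (light_event \<delta> (H n) (v n) (w n) t')
      \<le> prob_field_time_less F (H n) (v n) (w n) (c * t')"
      by (rule measure_light_event_le[OF H t'(1)])
    also have "\<dots> \<le> prob_field_time_less F (H n) (v n) (w n) s"
      unfolding prob_field_time_less_def
      by (rule F.pps.finite_measure_mono) (use t'(2) in \<open>auto intro: order.strict_trans\<close>)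
    finally show ?thesis .
  qed
  then show ?thesis
    by (intro tendsto_sandwich[OF _ _ light tendsto_const])
      (simp_all add: prob_field_time_less_bounds[OF borel_prob])
qed

text \<open>The three terms correspond to values \<open>r\<close> above \<open>s\<close>, between \<open>a - \<epsilon>\<close> and \<open>s\<close>, and below \<open>a - \<epsilon>\<close>;
  nonnegativity of \<open>r\<close> bounds the deviation by \<open>r\<close> in the first case and by \<open>a\<close> in the last.\<close>

lemma deviation_le:
  fixes r :: ereal and a s \<epsilon> :: real
  assumes "0 \<le> r" "0 \<le> a" "a \<le> s" "0 < \<epsilon>"
  shows "e2ennreal \<bar>r - ereal a\<bar> \<le> e2ennreal r * indicator {ereal s..} r + ennreal (s - a + \<epsilon>)
    + ennreal a * indicator {..<ereal (a - \<epsilon>)} r"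
proof (cases r)
  case (real x)
  have dev: "e2ennreal \<bar>r - ereal a\<bar> = ennreal \<bar>x - a\<bar>" by (simp add: real)
  consider "s \<le> x" | "a - \<epsilon> \<le> x" "x < s" | "x < a - \<epsilon>" by linarith
  then show ?thesis
  proof cases
    case 1
    then have "ennreal \<bar>x - a\<bar> \<le> ennreal x" using assms real by (intro ennreal_leI) auto
    then show ?thesis using 1 by (simp add: dev real add_increasing2 add_increasing)
  next
    case 2
    then have "ennreal \<bar>x - a\<bar> \<le> ennreal (s - a + \<epsilon>)" using assms by (intro ennreal_leI) auto
    then show ?thesis using 2 by (simp add: dev real)
  next
    case 3
    then have "ennreal \<bar>x - a\<bar> \<le> ennreal a" using assms real by (intro ennreal_leI) auto
    then show ?thesis using 3 by (simp add: dev real add_increasing)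
  qed
qed (use assms in auto)

text \<open>Off the light event \<open>T \<le> \<bar>T - t\<bar> + t\<close>, so the mean of \<open>T\<close> there is at most the \<open>L\<^sup>1\<close> distance
  of \<open>T\<close> to \<open>t\<close> plus \<open>t\<close> times the probability of the complement.  When \<open>T\<close> tends to \<open>t\<close> in mean along a
  sequence of graphs, everything on the right-hand side vanishes in the limit except for
  \<open>c t' - a + \<epsilon>\<close>, which can be made as small as desired.\<close>

lemma (in light_coupling) mean_deviation_le:
  assumes H: "bounded_degree_graph H" and K: "0 < K" and t': "0 \<le> t'" and t: "0 \<le> t"
    and a: "0 \<le> a" "a \<le> c * t'" and \<epsilon>: "0 < \<epsilon>"
    and mean: "\<And>x. 0 < x \<Longrightarrow> (\<integral>\<^sup>+z. ennreal (resampled_quantile F \<delta> x z) \<partial>Exp1) \<le> ennreal (K * x)"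
  shows "(\<integral>\<^sup>+x. e2ennreal \<bar>field_time H v w x - ereal a\<bar> \<partial>iid_field (edges H) F)
    \<le> ennreal K * ((\<integral>\<^sup>+y. e2ennreal \<bar>field_time H v w y - ereal t\<bar> \<partial>iid_field (edges H) Exp1)
        + ennreal (t * (1 - measure (iid_field (edges H) Exp1) (light_event \<delta> H v w t'))))
      + ennreal (c * t' - a + \<epsilon>) + ennreal (a * prob_field_time_less F H v w (a - \<epsilon>))"
proof -
  interpret bounded_degree_graph H by fact
  interpret E: borel_prob Exp1 by (rule borel_prob_Exp1)
  interpret F: borel_prob F by (rule borel_prob)
  let ?\<mu> = "iid_field (edges H) Exp1" and ?\<nu> = "iid_field (edges H) F"
  let ?T = "field_time H v w" and ?B = "light_event \<delta> H v w t'"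
  note [measurable] = measurable_field_time[OF borel_prob_Exp1] sets_light_event
  have [measurable]: "?T \<in> borel_measurable ?\<nu>" by (rule measurable_field_time[OF borel_prob])
  have [measurable]: "- ?B \<inter> space ?\<mu> \<in> sets ?\<mu>"
    using sets.compl_sets[OF sets_light_event] by (simp add: Diff_eq Int_commute)
  have "AE x in F. 0 \<le> x"
    by (rule AE_I[of _ _ "{..<0}"]) (auto simp: emeasure_eq_measure measure_neg)
  then have "AE x in ?\<nu>. \<forall>e\<in>edges H. 0 \<le> x e"
    using countable_edges prob_space_axioms
    by (subst AE_ball_countable) (auto intro!: AE_PiM_component[where P = "\<lambda>x. 0 \<le> x"])
  then have "AE x in ?\<nu>. e2ennreal \<bar>?T x - ereal a\<bar>
      \<le> e2ennreal (?T x) * indicator {ereal (c * t')..} (?T x) + ennreal (c * t' - a + \<epsilon>)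
        + ennreal a * indicator {..<ereal (a - \<epsilon>)} (?T x)"
    by eventually_elim (intro deviation_le field_time_nonneg a \<epsilon>, auto)
  then have "(\<integral>\<^sup>+x. e2ennreal \<bar>?T x - ereal a\<bar> \<partial>?\<nu>)
      \<le> (\<integral>\<^sup>+x. e2ennreal (?T x) * indicator {ereal (c * t')..} (?T x) + ennreal (c * t' - a + \<epsilon>)
        + ennreal a * indicator {..<ereal (a - \<epsilon>)} (?T x) \<partial>?\<nu>)"
    by (rule nn_integral_mono_AE)
  also have "\<dots> = (\<integral>\<^sup>+x. e2ennreal (?T x) * indicator {ereal (c * t')..} (?T x) \<partial>?\<nu>)
      + ennreal (c * t' - a + \<epsilon>) + ennreal a * (\<integral>\<^sup>+x. indicator {..<ereal (a - \<epsilon>)} (?T x) \<partial>?\<nu>)"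
    by (simp add: nn_integral_add nn_integral_cmult F.pps.emeasure_space_1)
  also have "(\<integral>\<^sup>+x. indicator {..<ereal (a - \<epsilon>)} (?T x) \<partial>?\<nu>)
      = (\<integral>\<^sup>+x. indicator {x \<in> space ?\<nu>. ?T x < ereal (a - \<epsilon>)} x \<partial>?\<nu>)"
    by (intro nn_integral_cong) (auto simp: indicator_def)
  also have "\<dots> = ennreal (prob_field_time_less F H v w (a - \<epsilon>))"
    unfolding prob_field_time_less_def by (subst nn_integral_indicator) (auto simp: F.pps.emeasure_eq_measure)
  also have "ennreal a * \<dots> = ennreal (a * prob_field_time_less F H v w (a - \<epsilon>))"
    using a by (simp add: ennreal_mult prob_field_time_less_bounds[OF borel_prob])
  also have "(\<integral>\<^sup>+x. e2ennreal (?T x) * indicator {ereal (c * t')..} (?T x) \<partial>?\<nu>)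
      \<le> ennreal K * (\<integral>\<^sup>+y. e2ennreal (?T y) * indicator (- ?B) y \<partial>?\<mu>)"
    by (rule upper_tail_mean[OF H K t' mean])
  also have "(\<integral>\<^sup>+y. e2ennreal (?T y) * indicator (- ?B) y \<partial>?\<mu>)
      \<le> (\<integral>\<^sup>+y. e2ennreal \<bar>?T y - ereal t\<bar> + ennreal t * indicator (space ?\<mu> - ?B) y \<partial>?\<mu>)"
  proof (rule nn_integral_mono)
    fix y assume y: "y \<in> space ?\<mu>"
    have "e2ennreal r \<le> e2ennreal \<bar>r - ereal t\<bar> + ennreal t" for r :: ereal
    proof (cases r)
      case (real x)
      have "ennreal x \<le> ennreal (\<bar>x - t\<bar> + t)" using t by (intro ennreal_leI) auto
      then show ?thesis using t by (simp add: real ennreal_plus)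
    qed auto
    then show "e2ennreal (?T y) * indicator (- ?B) y
        \<le> e2ennreal \<bar>?T y - ereal t\<bar> + ennreal t * indicator (space ?\<mu> - ?B) y"
      using y by (auto simp: indicator_def)
  qed
  also have "\<dots> = (\<integral>\<^sup>+y. e2ennreal \<bar>?T y - ereal t\<bar> \<partial>?\<mu>) + ennreal t * emeasure ?\<mu> (space ?\<mu> - ?B)"
    by (simp add: nn_integral_add nn_integral_cmult)
  also have "emeasure ?\<mu> (space ?\<mu> - ?B) = ennreal (1 - measure ?\<mu> ?B)"
    unfolding E.pps.emeasure_eq_measure by (subst E.pps.prob_compl) (auto intro: sets_light_event)
  also have "ennreal t * \<dots> = ennreal (t * (1 - measure ?\<mu> ?B))"
    using t by (simp add: ennreal_mult)
  finally show ?thesis by (simp add: add_right_mono mult_left_mono)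
qed

lemma mean_deviation_vanishes:
  fixes H :: "nat \<Rightarrow> ('v, 'e) mixed_graph"
  assumes F: "F \<in> class_C_L1 \<rho>" and \<rho>: "0 < \<rho>" and H: "\<And>n. bounded_degree_graph (H n)" and t: "0 \<le> t"
    and below: "\<And>\<epsilon>. 0 < \<epsilon> \<Longrightarrow> (\<lambda>n. prob_field_time_less Exp1 (H n) (v n) (w n) (t - \<epsilon>)) \<longlonglongrightarrow> 0"
    and above: "\<And>\<epsilon>. 0 < \<epsilon> \<Longrightarrow> (\<lambda>n. prob_field_time_less Exp1 (H n) (v n) (w n) (t + \<epsilon>)) \<longlonglongrightarrow> 1"
    and L1: "(\<lambda>n. \<integral>\<^sup>+y. e2ennreal \<bar>field_time (H n) (v n) (w n) y - ereal t\<bar> \<partial>iid_field (edges (H n)) Exp1) \<longlonglongrightarrow> 0"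
  shows "(\<lambda>n. \<integral>\<^sup>+x. e2ennreal \<bar>field_time (H n) (v n) (w n) x - ereal (t / \<rho>)\<bar> \<partial>iid_field (edges (H n)) F) \<longlonglongrightarrow> 0"
    (is "?I \<longlonglongrightarrow> 0")
proof (rule order_tendstoI)
  fix u :: ennreal assume "0 < u"
  then obtain e where e: "0 < e" "ennreal e < u"
    using dense[of 0 u] by (metis ennreal_cases ennreal_less_zero_iff less_top order.strict_trans top.not_eq_extremum)
  have F': "F \<in> class_C \<rho>" and int: "integrable F (\<lambda>x. x)" using F by (auto simp: class_C_L1_def)
  define a where "a = t / \<rho>"
  have a: "0 \<le> a" using t \<rho> by (simp add: a_def)
  have "t / \<rho> < a + e / 2" using e by (simp add: a_def)
  then obtain \<delta> c t' where "light_coupling F \<delta> c" and t': "0 \<le> t'" "a \<le> c * t'" "c * t' < a + e / 2" and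
    light: "(\<lambda>n. measure (iid_field (edges (H n)) Exp1) (light_event \<delta> (H n) (v n) (w n) t')) \<longlonglongrightarrow> 1"
    using exists_light_coupling[OF F' \<rho> H t _ below above, of "a + e / 2"] unfolding a_def by blast
  interpret light_coupling F \<delta> c by fact
  obtain K where K: "0 < K"
    "\<forall>x>0. (\<integral>\<^sup>+z. ennreal (resampled_quantile F \<delta> x z) \<partial>Exp1) \<le> ennreal (K * x)"
    using resampled_mean_le[OF int] by blast
  let ?p = "\<lambda>n. prob_field_time_less F (H n) (v n) (w n) (a - e / 4)"
  have p: "?p \<longlonglongrightarrow> 0"
  proof (rule lower_tail_vanishes[OF F' \<rho> H])
    show "\<rho> * (a - e / 4) < t - \<rho> * e / 8" using \<rho> e by (simp add: a_def algebra_simps)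
    show "(\<lambda>n. prob_field_time_less Exp1 (H n) (v n) (w n) (t - \<rho> * e / 8)) \<longlonglongrightarrow> 0"
      using \<rho> e by (intro below) simp
  qed
  let ?U = "\<lambda>n. ennreal K * ((\<integral>\<^sup>+y. e2ennreal \<bar>field_time (H n) (v n) (w n) y - ereal t\<bar> \<partial>iid_field (edges (H n)) Exp1)
        + ennreal (t * (1 - measure (iid_field (edges (H n)) Exp1) (light_event \<delta> (H n) (v n) (w n) t'))))
      + ennreal (c * t' - a + e / 4) + ennreal (a * ?p n)"
  have "?U \<longlonglongrightarrow> ennreal K * (0 + ennreal (t * (1 - 1))) + ennreal (c * t' - a + e / 4) + ennreal (a * 0)"
    by (intro tendsto_add ennreal_tendsto_cmult tendsto_ennrealI tendsto_mult tendsto_diff tendsto_const L1 light p) auto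
  then have "?U \<longlonglongrightarrow> ennreal (c * t' - a + e / 4)" by simp
  moreover have "ennreal (c * t' - a + e / 4) < u"
    by (rule le_less_trans[OF _ e(2)]) (use t' e in \<open>intro ennreal_leI, simp\<close>)
  ultimately have "\<forall>\<^sub>F n in sequentially. ?U n < u" by (rule order_tendstoD(2))
  then show "\<forall>\<^sub>F n in sequentially. ?I n < u"
  proof eventually_elim
    case (elim n)
    have "?I n \<le> ?U n"
      unfolding a_def[symmetric] using K e t'(2) a
      by (intro mean_deviation_le[OF H K(1) t'(1) t]) auto
    with elim show ?case by simp
  qed
qed simp

theorem theorem1p4:
  fixes \<rho> t :: real
    and F :: "real measure"
    and H :: "nat \<Rightarrow> ('v, 'e) mixed_graph"
    and v w :: "nat \<Rightarrow> 'v"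
    and M :: "nat \<Rightarrow> 'o measure" and X :: "nat \<Rightarrow> 'e \<Rightarrow> 'o \<Rightarrow> real"
    and M\<^sub>F :: "nat \<Rightarrow> 'p measure" and X\<^sub>F :: "nat \<Rightarrow> 'e \<Rightarrow> 'p \<Rightarrow> real"
  defines "T \<equiv> \<lambda>n. passage_time (H n) (X n) (v n) (w n)"
    and "T\<^sub>F \<equiv> \<lambda>n. passage_time (H n) (X\<^sub>F n) (v n) (w n)"
  assumes "\<rho> > 0" and "F \<in> class_C \<rho>" and "t \<ge> 0"
    and "\<And>n. bounded_degree_graph (H n)"
    and "\<And>n. v n \<in> verts (H n)" and "\<And>n. w n \<in> verts (H n)"
    and "\<And>n. iid_edge_times (M n) Exp1 (H n) (X n)"
    and "\<And>n. iid_edge_times (M\<^sub>F n) F (H n) (X\<^sub>F n)"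
  shows "(tendsto_in_prob M T t \<longrightarrow> tendsto_in_prob M\<^sub>F T\<^sub>F (t / \<rho>)) \<and>
         (F \<in> class_C_L1 \<rho> \<and> tendsto_in_L1 M T t \<longrightarrow> tendsto_in_L1 M\<^sub>F T\<^sub>F (t / \<rho>)) \<and>
         ((\<lambda>n. measure (M n) {\<omega> \<in> space (M n). T n \<omega> < ereal t}) \<longlonglongrightarrow> 0 \<longrightarrow>
          (\<exists>\<epsilon> :: nat \<Rightarrow> real. \<epsilon> \<longlonglongrightarrow> 0 \<and>
             (\<lambda>n. measure (M\<^sub>F n) {\<omega> \<in> space (M\<^sub>F n). T\<^sub>F n \<omega> < ereal (t / \<rho> - \<epsilon> n)}) \<longlonglongrightarrow> 0))"
proof -
  note \<rho> = assms(3) and F = assms(4) and t = assms(5) and H = assms(6)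
    and iid = assms(9) and iid\<^sub>F = assms(10)
  interpret nonneg_distribution F using F by (rule class_C_nonneg_distribution)
  let ?p = "\<lambda>F s n. prob_field_time_less F (H n) (v n) (w n) s"
  note tails = tendsto_in_prob_iff_tails[OF H borel_prob_Exp1 iid, where v = v and w = w and c = t]
    and tails\<^sub>F = tendsto_in_prob_iff_tails[OF H borel_prob iid\<^sub>F, where v = v and w = w and c = "t / \<rho>"]
  note less = bounded_degree_graph.measure_passage_time_less[OF H iid borel_prob_Exp1]
    and less\<^sub>F = bounded_degree_graph.measure_passage_time_less[OF H iid\<^sub>F borel_prob]
  have 1: "tendsto_in_prob M\<^sub>F T\<^sub>F (t / \<rho>)" if T: "tendsto_in_prob M T t"
    unfolding T\<^sub>F_def tails\<^sub>F
  proof (intro allI impI conjI)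
    fix \<epsilon> :: real assume \<epsilon>: "0 < \<epsilon>"
    \<comment> \<open>The lower tail needs a level strictly above \<open>\<rho> (t / \<rho> - \<epsilon>) = t - \<rho> \<epsilon>\<close>.\<close>
    have "?p Exp1 (t - \<rho> * \<epsilon> / 2) \<longlonglongrightarrow> 0" using T \<rho> \<epsilon> unfolding T_def tails by simp
    then show "?p F (t / \<rho> - \<epsilon>) \<longlonglongrightarrow> 0"
      by (rule lower_tail_vanishes[OF F \<rho> H, rotated]) (use \<rho> \<epsilon> in \<open>simp add: algebra_simps\<close>)
    show "?p F (t / \<rho> + \<epsilon>) \<longlonglongrightarrow> 1"
      by (rule upper_tail_vanishes[OF F \<rho> H t]) (use T \<epsilon> in \<open>simp_all add: T_def tails\<close>)
  qed
  have 2: "tendsto_in_L1 M\<^sub>F T\<^sub>F (t / \<rho>)" if L1: "F \<in> class_C_L1 \<rho>" "tendsto_in_L1 M T t"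
  proof -
    have "tendsto_in_prob M T t"
    proof (rule tendsto_in_L1_imp_in_prob[OF _ _ L1(2)])
      show "prob_space (M n)" for n using iid by (simp add: iid_edge_times_def)
      show "T n \<in> borel_measurable (M n)" for n
        unfolding T_def by (rule bounded_degree_graph.borel_measurable_passage_time[OF H iid])
    qed
    moreover have "(\<lambda>n. \<integral>\<^sup>+y. e2ennreal \<bar>field_time (H n) (v n) (w n) y - ereal t\<bar> \<partial>iid_field (edges (H n)) Exp1) \<longlonglongrightarrow> 0"
      using L1(2) unfolding tendsto_in_L1_def T_def
      by (subst (asm) bounded_degree_graph.nn_integral_passage_time[OF H iid borel_prob_Exp1,
            where g = "\<lambda>r. e2ennreal \<bar>r - ereal t\<bar>"]) auto
    ultimately have "(\<lambda>n. \<integral>\<^sup>+x. e2ennreal \<bar>field_time (H n) (v n) (w n) x - ereal (t / \<rho>)\<bar> \<partial>iid_field (edges (H n)) F) \<longlonglongrightarrow> 0"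
      by (intro mean_deviation_vanishes[OF L1(1) \<rho> H t]) (simp_all add: T_def tails)
    then show ?thesis
      unfolding tendsto_in_L1_def T\<^sub>F_def
      by (subst bounded_degree_graph.nn_integral_passage_time[OF H iid\<^sub>F borel_prob,
            where g = "\<lambda>r. e2ennreal \<bar>r - ereal (t / \<rho>)\<bar>"]) auto
  qed
  have 3: "\<exists>\<epsilon>. \<epsilon> \<longlonglongrightarrow> 0 \<and>
      (\<lambda>n. measure (M\<^sub>F n) {\<omega> \<in> space (M\<^sub>F n). T\<^sub>F n \<omega> < ereal (t / \<rho> - \<epsilon> n)}) \<longlonglongrightarrow> 0"
    if "(\<lambda>n. measure (M n) {\<omega> \<in> space (M n). T n \<omega> < ereal t}) \<longlonglongrightarrow> 0"
    unfolding T\<^sub>F_def less\<^sub>F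
  proof (rule diagonal_null_sequence[of "\<lambda>n \<epsilon>. ?p F (t / \<rho> - \<epsilon>) n"])
    fix \<epsilon> :: real assume \<epsilon>: "0 < \<epsilon>"
    have "?p Exp1 t \<longlonglongrightarrow> 0" using that unfolding T_def less .
    then show "?p F (t / \<rho> - \<epsilon>) \<longlonglongrightarrow> 0"
      by (rule lower_tail_vanishes[OF F \<rho> H, rotated]) (use \<rho> \<epsilon> in \<open>simp add: algebra_simps\<close>)
  qed (auto intro: prob_field_time_less_bounds borel_prob)
  show ?thesis using 1 2 3 by blast
qed

end
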